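(* Let $\mathcal H$ be a complete frame expanding the first-order $\Sigma$-structure $\mathcal A$, and let $\Gamma$ be a finite set of HoCHCs. If $\Gamma$ is $(\mathcal A,\mathcal H)$-unsatisfiable, then $\Gamma\Rightarrow^*\Gamma'\cup\{\bot\}$ for some set $\Gamma'$ of clauses.
   Context: Types. Fix a single base type $\iota$. Argument types $\tau::=\iota\mid\rho$; relational types $\rho::=o\mid\tau\to\rho$ (so every relational type is $\tau_1\to\cdots\to\tau_n\to o$); first-order types $\sigma_{FO}::=\iota\mid\iota\to o\mid\iota\to\sigma_{FO}$; types $\sigma::=\rho\mid\sigma_{FO}$. A fixed type environment $\Delta$ maps variables to argument types, with $\Delta^{-1}(\tau)$ infinite for each argument type $\tau$. A signature is a set of typed symbols $c:\sigma$ distinct from variables and from the logical symbols $\neg,\land,\lor,\exists_\tau$; it is first-order if all its types are first-order. Terms. Pre-terms $M::=x\mid c\mid\neg\mid\land\mid\lor\mid\exists_\tau\mid MM\mid\lambda x.M$, typed by: $x:\Delta(x)$; $c:\sigma$ for $c:\sigma$ in the signature; $M_1M_2:\sigma_2$ if $M_1:\sigma_1\to\sigma_2$, $M_2:\sigma_1$; $\lambda x.M:\Delta(x)\to\rho$ if $M:\rho$ with $\rho$ relational; $\land,\lor:o\to o\to o$; $\neg M:o$ if $M:o$; $\exists_\tau:(\tau\to o)\to o$. Typable pre-terms are terms; formulas are terms of type $o$; $\exists x.M$ abbreviates $\exists_\tau(\lambda x.M)$. A first-order $\Sigma$-formula uses only symbols of first-order type, variables of type $\iota$, and no $\lambda$.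 A term is positive existential if $\neg$ does not occur in it. $M[N/x]$ is capture-avoiding substitution. Semantics. A pre-frame $\mathcal H$ assigns to each type $\sigma$ a nonempty set $\mathcal H[\![\sigma]\!]$, with $\mathcal H[\![o]\!]=\{0,1\}$, $\mathcal H[\![\sigma_1\to\sigma_2]\!]$ a set of functions $\mathcal H[\![\sigma_1]\!]\to\mathcal H[\![\sigma_2]\!]$, containing binary $\min,\max$ on $\{0,1\}$ in $\mathcal H[\![o\to o\to o]\!]$ and, for each argument type $\tau$, $E_\tau(r)=\max\{r(s)\mid s\in\mathcal H[\![\tau]\!]\}$ in $\mathcal H[\![(\tau\to o)\to o]\!]$. A $(\Sigma,\mathcal H)$-structure $\mathcal B$ gives $c^{\mathcal B}\in\mathcal H[\![\sigma]\!]$ for $c:\sigma\in\Sigma$; a valuation $\alpha$ gives $\alpha(x)\in\mathcal H[\![\Delta(x)]\!]$. Denotation $[\![M]\!]^{\mathcal B}(\alpha)$ is standard ($\land,\lor$ as $\min,\max$; $\exists_\tau$ as $E_\tau$; $\neg$ as $1-\cdot$; application as function application), and $[\![\lambda x.M]\!]^{\mathcal B}(\alpha)$ is the function $r\mapsto[\![M]\!]^{\mathcal B}(\alpha[x\mapsto r])$ if it lies in $\mathcal H[\![\Delta(x)\to\rho]\!]$, otherwise an arbitrary element of that set. $\mathcal B,\alpha\models F$ iff $[\![F]\!]^{\mathcal B}(\alpha)=1$; $\mathcal B\models F$ iff this holds for all valuations. A frame is a pre-frame such that for all signatures, structures $\mathcal B$, valuations $\alpha$, positive existential terms $\lambda x.M$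 and $r$: $[\![\lambda x.M]\!]^{\mathcal B}(\alpha)(r)=[\![M]\!]^{\mathcal B}(\alpha[x\mapsto r])$. The order $\sqsubseteq$ is equality on $\iota$, $\le$ on $o$, pointwise on function types; a frame is complete if for each relational $\rho$ every subset of $\mathcal H[\![\rho]\!]$ has its pointwise least upper bound in $\mathcal H[\![\rho]\!]$. Background. Fix a first-order signature $\Sigma$ and a first-order $\Sigma$-structure $\mathcal A$ (all functions, domain $\mathcal A[\![\iota]\!]$). Fix $\Sigma'\supseteq\Sigma$ with $\Sigma'\setminus\Sigma$ consisting of symbols of relational type. A frame $\mathcal H$ expands $\mathcal A$ if $\mathcal H[\![\iota]\!]=\mathcal A[\![\iota]\!]$ and $c^{\mathcal A}\in\mathcal H[\![\sigma]\!]$ for $c:\sigma\in\Sigma$; a $(\Sigma',\mathcal H)$-expansion of $\mathcal A$ is a $(\Sigma',\mathcal H)$-structure agreeing with $\mathcal A$ on $\Sigma$. Clauses. An atom is a $\Sigma'$-formula containing no logical symbol; a background atom is an atom that is a first-order $\Sigma$-formula. A goal clause is $\neg A_1\lor\cdots\lor\neg A_n$ ($A_i$ atoms; $n=0$ gives the empty clause $\bot$); a definite clause is $G\lor R\,x_1\cdots x_n$ with $G$ a goal clause, $R\in\Sigma'\setminus\Sigma$ and $x_i$ distinct variables; a HoCHC is a goal or definite clause (free variables implicitly universally quantified). $\Gamma$ is $(\mathcal A,\mathcal H)$-satisfiable if some $(\Sigma',\mathcal H)$-expansion $\mathcal B$ of $\mathcal A$ satisfies $\mathcal B\models C$ for all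 $C\in\Gamma$. Proof system (rules applied to clauses of a set, modulo renaming of free variables): Resolution: from $\neg R\,M_1\cdots M_n\lor G$ and $G'\lor R\,x_1\cdots x_n$ derive $G\lor G'[M_1/x_1,\dots,M_n/x_n]$. $\beta$-Reduction: from $\neg(\lambda x.L)M\,N_1\cdots N_k\lor G$ derive $\neg L[M/x]N_1\cdots N_k\lor G$. Constraint refutation: from $G\lor\neg\phi_1\lor\cdots\lor\neg\phi_n$ derive $\bot$, provided every atom of $G$ has the form $x\,M_1\cdots M_k$ with $x$ a variable, each $\phi_i$ is a background atom, and some valuation $\alpha$ has $\mathcal A,\alpha\models\phi_1\land\cdots\land\phi_n$. $\Gamma'\Rightarrow\Gamma'\cup\{G\}$ if $G$ is derivable from $\Gamma'$ by one rule application; $\Rightarrow^*$ is its reflexive-transitive closure. *)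

theory Defs
  imports Main "HOL-Library.Multiset"
begin

section \<open>Types and signatures\<close>

datatype ty = Iota | Omicron | Arr ty ty (infixr \<open>\<rightarrow>\<^sub>t\<close> 60)

fun rel_ty :: "ty \<Rightarrow> bool" where
  "rel_ty Iota = False"
| "rel_ty Omicron = True"
| "rel_ty (\<tau> \<rightarrow>\<^sub>t \<rho>) = ((\<tau> = Iota \<or> rel_ty \<tau>) \<and> rel_ty \<rho>)"

definition arg_ty :: "ty \<Rightarrow> bool" where
  "arg_ty \<tau> \<longleftrightarrow> \<tau> = Iota \<or> rel_ty \<tau>"

text \<open>Note that \<open>o\<close> itself is not a first-order type.\<close>

fun fo_ty :: "ty \<Rightarrow> bool" where
  "fo_ty Iota = True"
| "fo_ty Omicron = False"
| "fo_ty (\<sigma>\<^sub>1 \<rightarrow>\<^sub>t \<sigma>\<^sub>2) = (\<sigma>\<^sub>1 = Iota \<and> (\<sigma>\<^sub>2 = Omicron \<or> fo_ty \<sigma>\<^sub>2))"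

definition is_ty :: "ty \<Rightarrow> bool" where
  "is_ty \<sigma> \<longleftrightarrow> rel_ty \<sigma> \<or> fo_ty \<sigma>"

fun arity :: "ty \<Rightarrow> nat" where
  "arity (\<sigma>\<^sub>1 \<rightarrow>\<^sub>t \<sigma>\<^sub>2) = Suc (arity \<sigma>\<^sub>2)"
| "arity _ = 0"

fun target :: "ty \<Rightarrow> ty" where
  "target (\<sigma>\<^sub>1 \<rightarrow>\<^sub>t \<sigma>\<^sub>2) = target \<sigma>\<^sub>2"
| "target \<sigma> = \<sigma>"

definition type_env :: "('v \<Rightarrow> ty) \<Rightarrow> bool" where
  "type_env \<Delta> \<longleftrightarrow> (\<forall>x. arg_ty (\<Delta> x)) \<and> (\<forall>\<tau>. arg_ty \<tau> \<longrightarrow> infinite {x. \<Delta> x = \<tau>})"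

type_synonym 'c sig = "'c \<Rightarrow> ty option"

definition signature :: "'c sig \<Rightarrow> bool" where
  "signature S \<longleftrightarrow> (\<forall>c \<sigma>. S c = Some \<sigma> \<longrightarrow> is_ty \<sigma>)"

definition fo_signature :: "'c sig \<Rightarrow> bool" where
  "fo_signature S \<longleftrightarrow> (\<forall>c \<sigma>. S c = Some \<sigma> \<longrightarrow> fo_ty \<sigma>)"

definition rel_extension :: "'c sig \<Rightarrow> 'c sig \<Rightarrow> bool" where
  "rel_extension S S' \<longleftrightarrow>
     S \<subseteq>\<^sub>m S' \<and> (\<forall>c \<sigma>. S' c = Some \<sigma> \<and> c \<notin> dom S \<longrightarrow> rel_ty \<sigma>)"

section \<open>Terms\<close>

datatype (cs: 'c, vs: 'v) trm =
    Var 'v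
  | Const 'c
  | Neg
  | Con
  | Dis
  | Ex ty
  | App "('c, 'v) trm" "('c, 'v) trm"
  | Lam 'v "('c, 'v) trm"

abbreviation apps :: "('c, 'v) trm \<Rightarrow> ('c, 'v) trm list \<Rightarrow> ('c, 'v) trm" where
  "apps M Ns \<equiv> foldl App M Ns"

text \<open>Negation is only typable when applied to an argument, since \<open>1 - _\<close> need not be an
  element of a frame.\<close>

inductive has_type :: "('v \<Rightarrow> ty) \<Rightarrow> 'c sig \<Rightarrow> ('c, 'v) trm \<Rightarrow> ty \<Rightarrow> bool"
  for \<Delta> S where
  Var: "has_type \<Delta> S (Var x) (\<Delta> x)"
| Const: "S c = Some \<sigma> \<Longrightarrow> has_type \<Delta> S (Const c) \<sigma>"
| App: "has_type \<Delta> S M\<^sub>1 (\<sigma>\<^sub>1 \<rightarrow>\<^sub>t \<sigma>\<^sub>2) \<Longrightarrow> has_type \<Delta> S M\<^sub>2 \<sigma>\<^sub>1 \<Longrightarrow>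
     has_type \<Delta> S (App M\<^sub>1 M\<^sub>2) \<sigma>\<^sub>2"
| Lam: "has_type \<Delta> S M \<rho> \<Longrightarrow> rel_ty \<rho> \<Longrightarrow> has_type \<Delta> S (Lam x M) (\<Delta> x \<rightarrow>\<^sub>t \<rho>)"
| Con: "has_type \<Delta> S Con (Omicron \<rightarrow>\<^sub>t Omicron \<rightarrow>\<^sub>t Omicron)"
| Dis: "has_type \<Delta> S Dis (Omicron \<rightarrow>\<^sub>t Omicron \<rightarrow>\<^sub>t Omicron)"
| Neg: "has_type \<Delta> S M Omicron \<Longrightarrow> has_type \<Delta> S (App Neg M) Omicron"
| Ex: "arg_ty \<tau> \<Longrightarrow> has_type \<Delta> S (Ex \<tau>) ((\<tau> \<rightarrow>\<^sub>t Omicron) \<rightarrow>\<^sub>t Omicron)"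

fun fv :: "('c, 'v) trm \<Rightarrow> 'v set" where
  "fv (Var x) = {x}"
| "fv (App M N) = fv M \<union> fv N"
| "fv (Lam x M) = fv M - {x}"
| "fv _ = {}"

fun pos_ex :: "('c, 'v) trm \<Rightarrow> bool" where
  "pos_ex Neg = False"
| "pos_ex (App M N) = (pos_ex M \<and> pos_ex N)"
| "pos_ex (Lam x M) = pos_ex M"
| "pos_ex _ = True"

fun no_logical :: "('c, 'v) trm \<Rightarrow> bool" where
  "no_logical (Var x) = True"
| "no_logical (Const c) = True"
| "no_logical (App M N) = (no_logical M \<and> no_logical N)"
| "no_logical (Lam x M) = no_logical M"
| "no_logical _ = False"

fun no_lam :: "('c, 'v) trm \<Rightarrow> bool" where
  "no_lam (App M N) = (no_lam M \<and> no_lam N)"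
| "no_lam (Lam x M) = False"
| "no_lam _ = True"

text \<open>Simultaneous capture-avoiding substitution. A bound variable is renamed, to a variable of
  the same type, exactly when it would capture a free variable of a substituted term.\<close>

primrec subst :: "('v \<Rightarrow> ty) \<Rightarrow> ('v \<Rightarrow> ('c, 'v) trm) \<Rightarrow> ('c, 'v) trm \<Rightarrow> ('c, 'v) trm" where
  "subst \<Delta> \<theta> (Var x) = \<theta> x"
| "subst \<Delta> \<theta> (Const c) = Const c"
| "subst \<Delta> \<theta> Neg = Neg"
| "subst \<Delta> \<theta> Con = Con"
| "subst \<Delta> \<theta> Dis = Dis"
| "subst \<Delta> \<theta> (Ex \<tau>) = Ex \<tau>"
| "subst \<Delta> \<theta> (App M N) = App (subst \<Delta> \<theta> M) (subst \<Delta> \<theta> N)"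
| "subst \<Delta> \<theta> (Lam x M) =
     (let V = (\<Union>z \<in> fv M - {x}. fv (\<theta> z));
          y = (if x \<notin> V then x else SOME y. \<Delta> y = \<Delta> x \<and> y \<notin> V)
      in Lam y (subst \<Delta> (\<theta>(x := Var y)) M))"

definition subst_list :: "'v list \<Rightarrow> ('c, 'v) trm list \<Rightarrow> 'v \<Rightarrow> ('c, 'v) trm" where
  "subst_list xs Ms = (\<lambda>x. case map_of (zip xs Ms) x of Some M \<Rightarrow> M | None \<Rightarrow> Var x)"

section \<open>Frames\<close>

text \<open>
  All semantic objects live in one type \<open>'d\<close>. The function space of a pre-frame at
  \<open>\<sigma>\<^sub>1 \<rightarrow>\<^sub>t \<sigma>\<^sub>2\<close> is a set of elements \<open>f\<close> of \<open>'d\<close>, where \<open>f\<close> stands for the function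
  \<open>a \<mapsto> ap H f a\<close> on \<open>carr H \<sigma>\<^sub>1\<close>; extensionality (in \<open>preframe\<close>) makes this
  identification injective. The truth values 0 and 1 are \<open>tv H False\<close> and \<open>tv H True\<close>.
\<close>

record 'd frm =
  carr :: "ty \<Rightarrow> 'd set"
  ap :: "'d \<Rightarrow> 'd \<Rightarrow> 'd"
  tv :: "bool \<Rightarrow> 'd"

definition is_min :: "'d frm \<Rightarrow> 'd \<Rightarrow> bool" where
  "is_min H f \<longleftrightarrow> f \<in> carr H (Omicron \<rightarrow>\<^sub>t Omicron \<rightarrow>\<^sub>t Omicron) \<and>
     (\<forall>a b. ap H (ap H f (tv H a)) (tv H b) = tv H (a \<and> b))"

definition is_max :: "'d frm \<Rightarrow> 'd \<Rightarrow> bool" where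
  "is_max H f \<longleftrightarrow> f \<in> carr H (Omicron \<rightarrow>\<^sub>t Omicron \<rightarrow>\<^sub>t Omicron) \<and>
     (\<forall>a b. ap H (ap H f (tv H a)) (tv H b) = tv H (a \<or> b))"

definition is_E :: "'d frm \<Rightarrow> ty \<Rightarrow> 'd \<Rightarrow> bool" where
  "is_E H \<tau> e \<longleftrightarrow> e \<in> carr H ((\<tau> \<rightarrow>\<^sub>t Omicron) \<rightarrow>\<^sub>t Omicron) \<and>
     (\<forall>r \<in> carr H (\<tau> \<rightarrow>\<^sub>t Omicron). ap H e r = tv H (\<exists>s \<in> carr H \<tau>. ap H r s = tv H True))"

definition preframe :: "'d frm \<Rightarrow> bool" where
  "preframe H \<longleftrightarrow>
     (\<forall>\<sigma>. is_ty \<sigma> \<longrightarrow> carr H \<sigma> \<noteq> {}) \<and>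
     tv H False \<noteq> tv H True \<and> carr H Omicron = {tv H False, tv H True} \<and>
     (\<forall>\<sigma>\<^sub>1 \<sigma>\<^sub>2. is_ty (\<sigma>\<^sub>1 \<rightarrow>\<^sub>t \<sigma>\<^sub>2) \<longrightarrow>
        (\<forall>f \<in> carr H (\<sigma>\<^sub>1 \<rightarrow>\<^sub>t \<sigma>\<^sub>2). \<forall>a \<in> carr H \<sigma>\<^sub>1. ap H f a \<in> carr H \<sigma>\<^sub>2) \<and>
        (\<forall>f \<in> carr H (\<sigma>\<^sub>1 \<rightarrow>\<^sub>t \<sigma>\<^sub>2). \<forall>g \<in> carr H (\<sigma>\<^sub>1 \<rightarrow>\<^sub>t \<sigma>\<^sub>2).
           (\<forall>a \<in> carr H \<sigma>\<^sub>1. ap H f a = ap H g a) \<longrightarrow> f = g)) \<and>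
     (\<exists>f. is_min H f) \<and> (\<exists>f. is_max H f) \<and> (\<forall>\<tau>. arg_ty \<tau> \<longrightarrow> (\<exists>e. is_E H \<tau> e))"

text \<open>The element for the function \<open>F\<close> if there is one, otherwise an arbitrary element.\<close>

definition lam_el :: "'d frm \<Rightarrow> ty \<Rightarrow> ty \<Rightarrow> ('d \<Rightarrow> 'd) \<Rightarrow> 'd" where
  "lam_el H \<sigma>\<^sub>1 \<sigma>\<^sub>2 F =
     (if \<exists>f \<in> carr H (\<sigma>\<^sub>1 \<rightarrow>\<^sub>t \<sigma>\<^sub>2). \<forall>a \<in> carr H \<sigma>\<^sub>1. ap H f a = F a
      then THE f. f \<in> carr H (\<sigma>\<^sub>1 \<rightarrow>\<^sub>t \<sigma>\<^sub>2) \<and> (\<forall>a \<in> carr H \<sigma>\<^sub>1. ap H f a = F a)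
      else SOME f. f \<in> carr H (\<sigma>\<^sub>1 \<rightarrow>\<^sub>t \<sigma>\<^sub>2))"

definition struct :: "'c sig \<Rightarrow> 'd frm \<Rightarrow> ('c \<Rightarrow> 'd) \<Rightarrow> bool" where
  "struct S H B \<longleftrightarrow> (\<forall>c \<sigma>. S c = Some \<sigma> \<longrightarrow> B c \<in> carr H \<sigma>)"

definition valuation :: "('v \<Rightarrow> ty) \<Rightarrow> 'd frm \<Rightarrow> ('v \<Rightarrow> 'd) \<Rightarrow> bool" where
  "valuation \<Delta> H \<alpha> \<longleftrightarrow> (\<forall>x. \<alpha> x \<in> carr H (\<Delta> x))"

text \<open>The denotation is only meaningful for typable terms; in particular \<open>Neg\<close> denotes
  something only when applied.\<close>

primrec denot ::
  "('v \<Rightarrow> ty) \<Rightarrow> 'c sig \<Rightarrow> 'd frm \<Rightarrow> ('c \<Rightarrow> 'd) \<Rightarrow> ('c, 'v) trm \<Rightarrow> ('v \<Rightarrow> 'd) \<Rightarrow> 'd" where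
  "denot \<Delta> S H B (Var x) \<alpha> = \<alpha> x"
| "denot \<Delta> S H B (Const c) \<alpha> = B c"
| "denot \<Delta> S H B Neg \<alpha> = undefined"
| "denot \<Delta> S H B Con \<alpha> = (THE f. is_min H f)"
| "denot \<Delta> S H B Dis \<alpha> = (THE f. is_max H f)"
| "denot \<Delta> S H B (Ex \<tau>) \<alpha> = (THE e. is_E H \<tau> e)"
| "denot \<Delta> S H B (App M N) \<alpha> =
     (if M = Neg then tv H (denot \<Delta> S H B N \<alpha> \<noteq> tv H True)
      else ap H (denot \<Delta> S H B M \<alpha>) (denot \<Delta> S H B N \<alpha>))"
| "denot \<Delta> S H B (Lam x M) \<alpha> =
     lam_el H (\<Delta> x) (THE \<rho>. has_type \<Delta> S M \<rho>) (\<lambda>r. denot \<Delta> S H B M (\<alpha>(x := r)))"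

definition sat ::
  "('v \<Rightarrow> ty) \<Rightarrow> 'c sig \<Rightarrow> 'd frm \<Rightarrow> ('c \<Rightarrow> 'd) \<Rightarrow> ('v \<Rightarrow> 'd) \<Rightarrow> ('c, 'v) trm \<Rightarrow> bool" where
  "sat \<Delta> S H B \<alpha> F \<longleftrightarrow> denot \<Delta> S H B F \<alpha> = tv H True"

text \<open>The type argument is the supply of symbols from which signatures are drawn.\<close>

definition frame :: "'c itself \<Rightarrow> ('v \<Rightarrow> ty) \<Rightarrow> 'd frm \<Rightarrow> bool" where
  "frame _ \<Delta> H \<longleftrightarrow> preframe H \<and>
     (\<forall>(S :: 'c sig) B \<alpha> x M \<sigma>. signature S \<and> struct S H B \<and> valuation \<Delta> H \<alpha> \<and>
        has_type \<Delta> S (Lam x M) \<sigma> \<and> pos_ex (Lam x M) \<longrightarrow>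
        (\<forall>r \<in> carr H (\<Delta> x).
           ap H (denot \<Delta> S H B (Lam x M) \<alpha>) r = denot \<Delta> S H B M (\<alpha>(x := r))))"

text \<open>\<open>u\<close> is the least upper bound of \<open>X\<close> with respect to the pointwise order, computed
  pointwise down to the truth values (where it is the maximum, 0 for the empty set).\<close>

fun pointwise_lub :: "'d frm \<Rightarrow> ty \<Rightarrow> 'd set \<Rightarrow> 'd \<Rightarrow> bool" where
  "pointwise_lub H Iota X u = False"
| "pointwise_lub H Omicron X u = (u = tv H (\<exists>v \<in> X. v = tv H True))"
| "pointwise_lub H (\<tau> \<rightarrow>\<^sub>t \<rho>) X u =
     (\<forall>a \<in> carr H \<tau>. pointwise_lub H \<rho> ((\<lambda>f. ap H f a) ` X) (ap H u a))"

definition complete_frame :: "'c itself \<Rightarrow> ('v \<Rightarrow> ty) \<Rightarrow> 'd frm \<Rightarrow> bool" where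
  "complete_frame C \<Delta> H \<longleftrightarrow> frame C \<Delta> H \<and>
     (\<forall>\<rho>. rel_ty \<rho> \<longrightarrow> (\<forall>X \<subseteq> carr H \<rho>. \<exists>u \<in> carr H \<rho>. pointwise_lub H \<rho> X u))"

section \<open>The background structure\<close>

text \<open>A first-order structure interprets a symbol of type \<open>\<iota>\<^sup>n \<rightarrow> \<iota>\<close> by an \<open>n\<close>-ary operation
  and a symbol of type \<open>\<iota>\<^sup>n \<rightarrow> o\<close> by an \<open>n\<close>-ary relation, with arguments given as a list.\<close>

record ('c, 'd) fo_str =
  fdom :: "'d set"
  fop :: "'c \<Rightarrow> 'd list \<Rightarrow> 'd"
  frel :: "'c \<Rightarrow> 'd list \<Rightarrow> bool"

definition fo_structure :: "'c sig \<Rightarrow> ('c, 'd) fo_str \<Rightarrow> bool" where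
  "fo_structure S A \<longleftrightarrow> fdom A \<noteq> {} \<and>
     (\<forall>c \<sigma> as. S c = Some \<sigma> \<and> target \<sigma> = Iota \<and> set as \<subseteq> fdom A \<and> length as = arity \<sigma> \<longrightarrow>
        fop A c as \<in> fdom A)"

text \<open>The element \<open>d\<close> of a frame is the curried form of the interpretation of \<open>c : \<sigma>\<close>.\<close>

definition represents :: "'d frm \<Rightarrow> ('c, 'd) fo_str \<Rightarrow> 'c \<Rightarrow> ty \<Rightarrow> 'd \<Rightarrow> bool" where
  "represents H A c \<sigma> d \<longleftrightarrow>
     (\<forall>as. set as \<subseteq> fdom A \<and> length as = arity \<sigma> \<longrightarrow>
        foldl (ap H) d as = (if target \<sigma> = Iota then fop A c as else tv H (frel A c as)))"

definition expands :: "'c sig \<Rightarrow> ('c, 'd) fo_str \<Rightarrow> 'd frm \<Rightarrow> bool" where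
  "expands S A H \<longleftrightarrow> carr H Iota = fdom A \<and>
     (\<forall>c \<sigma>. S c = Some \<sigma> \<longrightarrow> (\<exists>d \<in> carr H \<sigma>. represents H A c \<sigma> d))"

definition expansion ::
  "'c sig \<Rightarrow> 'c sig \<Rightarrow> ('c, 'd) fo_str \<Rightarrow> 'd frm \<Rightarrow> ('c \<Rightarrow> 'd) \<Rightarrow> bool" where
  "expansion S S' A H B \<longleftrightarrow> struct S' H B \<and>
     (\<forall>c \<sigma>. S c = Some \<sigma> \<longrightarrow> represents H A c \<sigma> (B c))"

definition fo_valuation :: "('v \<Rightarrow> ty) \<Rightarrow> ('c, 'd) fo_str \<Rightarrow> ('v \<Rightarrow> 'd) \<Rightarrow> bool" where
  "fo_valuation \<Delta> A \<alpha> \<longleftrightarrow> (\<forall>x. \<Delta> x = Iota \<longrightarrow> \<alpha> x \<in> fdom A)"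

text \<open>Truth of background atoms in \<open>A\<close>. The list argument accumulates the values of the
  arguments to which the current term is applied.\<close>

fun fo_val :: "('c, 'd) fo_str \<Rightarrow> ('v \<Rightarrow> 'd) \<Rightarrow> ('c, 'v) trm \<Rightarrow> 'd list \<Rightarrow> 'd" where
  "fo_val A \<alpha> (Var x) as = \<alpha> x"
| "fo_val A \<alpha> (Const c) as = fop A c as"
| "fo_val A \<alpha> (App M N) as = fo_val A \<alpha> M (fo_val A \<alpha> N [] # as)"
| "fo_val A \<alpha> _ as = undefined"

fun fo_holds :: "('c, 'd) fo_str \<Rightarrow> ('v \<Rightarrow> 'd) \<Rightarrow> ('c, 'v) trm \<Rightarrow> 'd list \<Rightarrow> bool" where
  "fo_holds A \<alpha> (Const c) as = frel A c as"
| "fo_holds A \<alpha> (App M N) as = fo_holds A \<alpha> M (fo_val A \<alpha> N [] # as)"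
| "fo_holds A \<alpha> _ as = undefined"

definition fo_sat :: "('c, 'd) fo_str \<Rightarrow> ('v \<Rightarrow> 'd) \<Rightarrow> ('c, 'v) trm \<Rightarrow> bool" where
  "fo_sat A \<alpha> \<phi> \<longleftrightarrow> fo_holds A \<alpha> \<phi> []"

section \<open>Clauses\<close>

definition atom :: "('v \<Rightarrow> ty) \<Rightarrow> 'c sig \<Rightarrow> ('c, 'v) trm \<Rightarrow> bool" where
  "atom \<Delta> S' M \<longleftrightarrow> has_type \<Delta> S' M Omicron \<and> no_logical M"

definition fo_formula :: "('v \<Rightarrow> ty) \<Rightarrow> 'c sig \<Rightarrow> ('c, 'v) trm \<Rightarrow> bool" where
  "fo_formula \<Delta> S M \<longleftrightarrow> has_type \<Delta> S M Omicron \<and> no_lam M \<and>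
     (\<forall>c \<in> cs M. \<exists>\<sigma>. S c = Some \<sigma> \<and> fo_ty \<sigma>) \<and> (\<forall>x \<in> vs M. \<Delta> x = Iota)"

definition background_atom :: "('v \<Rightarrow> ty) \<Rightarrow> 'c sig \<Rightarrow> 'c sig \<Rightarrow> ('c, 'v) trm \<Rightarrow> bool" where
  "background_atom \<Delta> S S' M \<longleftrightarrow> atom \<Delta> S' M \<and> fo_formula \<Delta> S M"

text \<open>\<open>Goal {#A\<^sub>1, \<dots>, A\<^sub>n#}\<close> is the clause \<open>\<not>A\<^sub>1 \<or> \<dots> \<or> \<not>A\<^sub>n\<close>, and
  \<open>Definite {#A\<^sub>1, \<dots>, A\<^sub>n#} R [x\<^sub>1, \<dots>, x\<^sub>m]\<close> is \<open>\<not>A\<^sub>1 \<or> \<dots> \<or> \<not>A\<^sub>n \<or> R x\<^sub>1 \<dots> x\<^sub>m\<close>;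
  multisets account for disjunction being read modulo associativity and commutativity.\<close>

datatype ('c, 'v) clause =
    Goal "('c, 'v) trm multiset"
  | Definite "('c, 'v) trm multiset" 'c "'v list"

abbreviation empty_clause :: "('c, 'v) clause" where
  "empty_clause \<equiv> Goal {#}"

fun HoCHC :: "('v \<Rightarrow> ty) \<Rightarrow> 'c sig \<Rightarrow> 'c sig \<Rightarrow> ('c, 'v) clause \<Rightarrow> bool" where
  "HoCHC \<Delta> S S' (Goal G) = (\<forall>M \<in># G. atom \<Delta> S' M)"
| "HoCHC \<Delta> S S' (Definite G R xs) =
     ((\<forall>M \<in># G. atom \<Delta> S' M) \<and> R \<in> dom S' - dom S \<and> distinct xs \<and>
      has_type \<Delta> S' (apps (Const R) (map Var xs)) Omicron)"

fun sat_clause ::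
  "('v \<Rightarrow> ty) \<Rightarrow> 'c sig \<Rightarrow> 'd frm \<Rightarrow> ('c \<Rightarrow> 'd) \<Rightarrow> ('v \<Rightarrow> 'd) \<Rightarrow> ('c, 'v) clause \<Rightarrow> bool" where
  "sat_clause \<Delta> S' H B \<alpha> (Goal G) = (\<exists>M \<in># G. sat \<Delta> S' H B \<alpha> (App Neg M))"
| "sat_clause \<Delta> S' H B \<alpha> (Definite G R xs) =
     ((\<exists>M \<in># G. sat \<Delta> S' H B \<alpha> (App Neg M)) \<or>
      sat \<Delta> S' H B \<alpha> (apps (Const R) (map Var xs)))"

definition satisfiable ::
  "('v \<Rightarrow> ty) \<Rightarrow> 'c sig \<Rightarrow> 'c sig \<Rightarrow> ('c, 'd) fo_str \<Rightarrow> 'd frm \<Rightarrow> ('c, 'v) clause set \<Rightarrow> bool"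
where
  "satisfiable \<Delta> S S' A H \<Gamma> \<longleftrightarrow>
     (\<exists>B. expansion S S' A H B \<and>
        (\<forall>C \<in> \<Gamma>. \<forall>\<alpha>. valuation \<Delta> H \<alpha> \<longrightarrow> sat_clause \<Delta> S' H B \<alpha> C))"

section \<open>The proof system\<close>

fun fv_clause :: "('c, 'v) clause \<Rightarrow> 'v set" where
  "fv_clause (Goal G) = (\<Union>M \<in> set_mset G. fv M)"
| "fv_clause (Definite G R xs) = (\<Union>M \<in> set_mset G. fv M) \<union> set xs"

fun rename_clause :: "('v \<Rightarrow> ty) \<Rightarrow> ('v \<Rightarrow> 'v) \<Rightarrow> ('c, 'v) clause \<Rightarrow> ('c, 'v) clause" where
  "rename_clause \<Delta> \<pi> (Goal G) = Goal (image_mset (subst \<Delta> (\<lambda>x. Var (\<pi> x))) G)"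
| "rename_clause \<Delta> \<pi> (Definite G R xs) =
     Definite (image_mset (subst \<Delta> (\<lambda>x. Var (\<pi> x))) G) R (map \<pi> xs)"

definition variant :: "('v \<Rightarrow> ty) \<Rightarrow> ('c, 'v) clause \<Rightarrow> ('c, 'v) clause \<Rightarrow> bool" where
  "variant \<Delta> C C' \<longleftrightarrow>
     (\<exists>\<pi>. inj_on \<pi> (fv_clause C) \<and> (\<forall>x \<in> fv_clause C. \<Delta> (\<pi> x) = \<Delta> x) \<and>
          C' = rename_clause \<Delta> \<pi> C)"

inductive derivable ::
  "('v \<Rightarrow> ty) \<Rightarrow> 'c sig \<Rightarrow> 'c sig \<Rightarrow> ('c, 'd) fo_str \<Rightarrow> ('c, 'v) clause set \<Rightarrow>
   ('c, 'v) clause \<Rightarrow> bool"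
  for \<Delta> S S' A \<Gamma> where
  resolution:
    "\<lbrakk> C \<in> \<Gamma>; variant \<Delta> C (Goal (add_mset (apps (Const R) Ms) G));
       D \<in> \<Gamma>; variant \<Delta> D (Definite G' R xs); length Ms = length xs \<rbrakk> \<Longrightarrow>
     derivable \<Delta> S S' A \<Gamma> (Goal (G + image_mset (subst \<Delta> (subst_list xs Ms)) G'))"
| beta:
    "\<lbrakk> C \<in> \<Gamma>; variant \<Delta> C (Goal (add_mset (apps (App (Lam x L) M) Ns) G)) \<rbrakk> \<Longrightarrow>
     derivable \<Delta> S S' A \<Gamma> (Goal (add_mset (apps (subst \<Delta> (Var(x := M)) L) Ns) G))"
| constraint_refutation:
    "\<lbrakk> C \<in> \<Gamma>; variant \<Delta> C (Goal (G + \<Phi>));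
       \<forall>N \<in># G. \<exists>x Ms. N = apps (Var x) Ms;
       \<forall>\<phi> \<in># \<Phi>. background_atom \<Delta> S S' \<phi>;
       \<exists>\<alpha>. fo_valuation \<Delta> A \<alpha> \<and> (\<forall>\<phi> \<in># \<Phi>. fo_sat A \<alpha> \<phi>) \<rbrakk> \<Longrightarrow>
     derivable \<Delta> S S' A \<Gamma> empty_clause"

definition step ::
  "('v \<Rightarrow> ty) \<Rightarrow> 'c sig \<Rightarrow> 'c sig \<Rightarrow> ('c, 'd) fo_str \<Rightarrow> ('c, 'v) clause set \<Rightarrow>
   ('c, 'v) clause set \<Rightarrow> bool" where
  "step \<Delta> S S' A \<Gamma> \<Gamma>' \<longleftrightarrow> (\<exists>G. derivable \<Delta> S S' A \<Gamma> G \<and> \<Gamma>' = \<Gamma> \<union> {G})"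

end

theory Submission
  imports Defs
begin

text \<open>
  The proof is a reducibility argument. A logical relation links terms to elements of the frame: at
  type \<open>o\<close>, a term is related to 1 only if, whenever a goal can be refuted, so can that goal
  extended by the term; at type \<open>\<iota>\<close>, a term is related to its value in the background structure.
  Variables of relational type are related to everything, because constraint refutation discards
  atoms headed by a variable. The relation is closed under \<open>\<beta>\<close>-expansion and, in its second
  argument, under pointwise least upper bounds. Completeness of the frame therefore allows
  interpreting each \<open>R\<close> outside the background signature by the largest element related to \<open>R\<close>
  itself. By the fundamental lemma every term is related to its denotation in this structure. Hence
  the resolution rule makes the element denoted by \<open>\<lambda>x\<^sub>1 \<dots> x\<^sub>n. body\<close> of a definite clause for \<open>R\<close>
  related to \<open>R\<close>, so the structure satisfies all definite clauses, and a goal clause that it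
  falsifies is refutable.
\<close>

section \<open>Typing and substitution\<close>

inductive_cases has_type_ConstE: "has_type \<Delta> S (Const c) \<sigma>"
inductive_cases has_type_NegE: "has_type \<Delta> S Neg \<sigma>"
inductive_cases has_type_AppE: "has_type \<Delta> S (App M N) \<sigma>"
inductive_cases has_type_LamE: "has_type \<Delta> S (Lam x M) \<sigma>"
inductive_cases has_type_VarE: "has_type \<Delta> S (Var x) \<sigma>"
inductive_cases has_type_ConE: "has_type \<Delta> S Con \<sigma>"
inductive_cases has_type_DisE: "has_type \<Delta> S Dis \<sigma>"
inductive_cases has_type_ExE: "has_type \<Delta> S (Ex \<tau>) \<sigma>"

text \<open>The environment fixes the types of all variables, bound ones included, and the typing
  rules for application and for negation do not overlap because \<open>Neg\<close> alone has no
  type. Uniqueness gives meaning to the description operator in the denotation of an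
  abstraction.\<close>

lemma has_type_unique:
  assumes "has_type \<Delta> S M \<sigma>" "has_type \<Delta> S M \<sigma>'"
  shows "\<sigma> = \<sigma>'"
  using assms
proof (induction arbitrary: \<sigma>')
  case (Var x)
  then show ?case by (rule has_type_VarE) simp
next
  case (Const c \<sigma>)
  from Const.prems Const.hyps show ?case by (auto elim: has_type_ConstE)
next
  case (App M\<^sub>1 \<sigma>\<^sub>1 \<sigma>\<^sub>2 M\<^sub>2)
  from App.prems show ?case
  proof (rule has_type_AppE)
    fix \<tau> assume "has_type \<Delta> S M\<^sub>1 (\<tau> \<rightarrow>\<^sub>t \<sigma>')"
    from App.IH(1)[OF this] show ?thesis by simp
  next
    assume "M\<^sub>1 = Neg"
    with App.hyps(1) show ?thesis by (auto elim: has_type_NegE)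
  qed
next
  case (Lam M \<rho> x)
  from Lam.prems obtain \<rho>' where "has_type \<Delta> S M \<rho>'" "\<sigma>' = \<Delta> x \<rightarrow>\<^sub>t \<rho>'"
    by (rule has_type_LamE)
  with Lam.IH show ?case by simp
next
  case Con
  then show ?case by (rule has_type_ConE) simp
next
  case Dis
  then show ?case by (rule has_type_DisE) simp
next
  case (Neg M)
  from Neg.prems show ?case by (rule has_type_AppE) (auto elim: has_type_NegE)
next
  case (Ex \<tau>)
  from Ex.prems show ?case by (rule has_type_ExE) simp
qed

lemma has_type_mono:
  assumes "has_type \<Delta> S M \<sigma>" "S \<subseteq>\<^sub>m S'"
  shows "has_type \<Delta> S' M \<sigma>"
  using assms by induction (auto intro: has_type.intros simp: map_le_def dom_def)

lemma has_type_AppD: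
  assumes "has_type \<Delta> S (App M N) \<sigma>" "M \<noteq> Neg"
  obtains \<tau> where "has_type \<Delta> S M (\<tau> \<rightarrow>\<^sub>t \<sigma>)" "has_type \<Delta> S N \<tau>"
  using assms by (auto elim: has_type_AppE)

lemma apps_neq_Neg: "M \<noteq> Neg \<Longrightarrow> apps M Ns \<noteq> Neg"
  by (induction Ns rule: rev_induct) auto

lemma has_type_appsD:
  assumes "has_type \<Delta> S (apps M Ns) \<sigma>" "M \<noteq> Neg"
  shows "\<exists>\<sigma>s. has_type \<Delta> S M (foldr Arr \<sigma>s \<sigma>) \<and> list_all2 (has_type \<Delta> S) Ns \<sigma>s"
  using assms(1)
proof (induction Ns arbitrary: \<sigma> rule: rev_induct)
  case Nil
  then show ?case by (intro exI[of _ "[]"]) simp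
next
  case (snoc N Ns)
  then have "has_type \<Delta> S (App (apps M Ns) N) \<sigma>" by simp
  then obtain \<tau> where t: "has_type \<Delta> S (apps M Ns) (\<tau> \<rightarrow>\<^sub>t \<sigma>)" "has_type \<Delta> S N \<tau>"
    using apps_neq_Neg[OF assms(2)] by (rule has_type_AppD)
  from snoc.IH[OF t(1)] obtain \<sigma>s where
    "has_type \<Delta> S M (foldr Arr \<sigma>s (\<tau> \<rightarrow>\<^sub>t \<sigma>))" "list_all2 (has_type \<Delta> S) Ns \<sigma>s" by blast
  with t(2) show ?case
    by (intro exI[of _ "\<sigma>s @ [\<tau>]"]) (auto intro: list_all2_appendI)
qed

lemma has_type_appsI:
  assumes "has_type \<Delta> S M (foldr Arr \<sigma>s \<sigma>)" "list_all2 (has_type \<Delta> S) Ns \<sigma>s"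
  shows "has_type \<Delta> S (apps M Ns) \<sigma>"
  using assms(2,1)
  by (induction arbitrary: M) (auto intro: has_type.App)

lemma foldr_Arr_Omicron_inj:
  "foldr Arr \<sigma>s Omicron = foldr Arr \<tau>s Omicron \<Longrightarrow> \<sigma>s = \<tau>s"
proof (induction \<sigma>s arbitrary: \<tau>s)
  case Nil
  then show ?case by (cases \<tau>s) auto
next
  case (Cons \<sigma> \<sigma>s)
  then show ?case by (cases \<tau>s) auto
qed

lemma has_type_apps_VarsD:
  assumes "has_type \<Delta> S (apps (Const R) (map Var xs)) Omicron"
  shows "S R = Some (foldr Arr (map \<Delta> xs) Omicron)"
proof -
  from has_type_appsD[OF assms] obtain \<sigma>s where
    R: "has_type \<Delta> S (Const R) (foldr Arr \<sigma>s Omicron)"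
    and "list_all2 (has_type \<Delta> S) (map Var xs) \<sigma>s" by auto
  then have "\<sigma>s = map \<Delta> xs"
    by (auto simp: list_all2_conv_all_nth list_eq_iff_nth_eq elim!: has_type_VarE)
  with R show ?thesis by (auto elim: has_type_ConstE)
qed

lemma no_logical_apps [simp]:
  "no_logical (apps M Ns) \<longleftrightarrow> no_logical M \<and> (\<forall>N \<in> set Ns. no_logical N)"
  by (induction Ns arbitrary: M) auto

lemma no_logical_pos_ex: "no_logical M \<Longrightarrow> pos_ex M"
  by (induction M) auto

section \<open>Fresh variables and capture-avoiding substitution\<close>

lemma finite_fv [simp]: "finite (fv M)"
  by (induction M) auto

lemma type_env_fresh:
  assumes "type_env \<Delta>" "arg_ty \<tau>" "finite V"
  obtains y where "\<Delta> y = \<tau>" "y \<notin> V"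
proof -
  have "infinite ({x. \<Delta> x = \<tau>} - V)"
    using assms by (simp add: type_env_def)
  then have "{x. \<Delta> x = \<tau>} - V \<noteq> {}" by (metis finite.emptyI)
  then show thesis using that by blast
qed

text \<open>Built one variable at a time, as each argument type has infinitely many variables. It
  serves to rename a definite clause apart from the variables already in use.\<close>

lemma type_env_fresh_renaming:
  assumes "type_env \<Delta>" "finite X" "finite V"
  obtains \<pi> where "inj_on \<pi> X" "\<forall>x \<in> X. \<Delta> (\<pi> x) = \<Delta> x" "\<pi> ` X \<inter> V = {}"
proof -
  have "\<exists>\<pi>. inj_on \<pi> X \<and> (\<forall>x \<in> X. \<Delta> (\<pi> x) = \<Delta> x) \<and> \<pi> ` X \<inter> V = {}"
    using assms(2)
  proof (induction X rule: finite_induct)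
    case (insert x X)
    then obtain \<pi> where \<pi>: "inj_on \<pi> X" "\<forall>x \<in> X. \<Delta> (\<pi> x) = \<Delta> x" "\<pi> ` X \<inter> V = {}"
      by blast
    have "arg_ty (\<Delta> x)" "finite (V \<union> \<pi> ` X)"
      using assms insert(1) by (auto simp: type_env_def)
    then obtain y where "\<Delta> y = \<Delta> x" "y \<notin> V \<union> \<pi> ` X"
      by (rule type_env_fresh[OF assms(1)])
    with \<pi> insert(2) show ?case
      by (intro exI[of _ "\<pi>(x := y)"]) (auto simp: inj_on_def)
  qed simp
  then show thesis using that by blast
qed

text \<open>Hides how the bound variable is chosen: whether it is kept or renamed, its type and its
  freshness are what later arguments rely on.\<close>

lemma subst_Lam_fresh:
  assumes "type_env \<Delta>"
  obtains y where "subst \<Delta> \<theta> (Lam x M) = Lam y (subst \<Delta> (\<theta>(x := Var y)) M)"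
    "\<Delta> y = \<Delta> x" "\<And>z. z \<in> fv M - {x} \<Longrightarrow> y \<notin> fv (\<theta> z)"
proof -
  define V where "V = (\<Union>z \<in> fv M - {x}. fv (\<theta> z))"
  define y where "y = (if x \<notin> V then x else SOME y. \<Delta> y = \<Delta> x \<and> y \<notin> V)"
  have "\<exists>y. \<Delta> y = \<Delta> x \<and> y \<notin> V"
  proof (rule type_env_fresh[OF assms, of "\<Delta> x" V])
    show "arg_ty (\<Delta> x)" "finite V" using assms by (auto simp: V_def type_env_def)
  qed blast
  then have "\<Delta> y = \<Delta> x \<and> y \<notin> V"
    using someI_ex[of "\<lambda>y. \<Delta> y = \<Delta> x \<and> y \<notin> V"] by (auto simp: y_def)
  moreover have "subst \<Delta> \<theta> (Lam x M) = Lam y (subst \<Delta> (\<theta>(x := Var y)) M)"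
    by (simp add: Let_def V_def y_def)
  ultimately show thesis using that by (auto simp: V_def)
qed

lemma fv_subst:
  assumes "type_env \<Delta>"
  shows "fv (subst \<Delta> \<theta> M) = (\<Union>z \<in> fv M. fv (\<theta> z))"
proof (induction M arbitrary: \<theta>)
  case (Lam x M)
  from assms obtain y where y: "subst \<Delta> \<theta> (Lam x M) = Lam y (subst \<Delta> (\<theta>(x := Var y)) M)"
    "\<And>z. z \<in> fv M - {x} \<Longrightarrow> y \<notin> fv (\<theta> z)"
    by (rule subst_Lam_fresh[of \<Delta> \<theta> x M]) auto
  show ?case
    unfolding y(1) using y(2) by (auto simp: Lam split: if_splits)
qed auto

text \<open>The equality is literal, not up to renaming: the new bound variable is a function of the
  set of variables to avoid, and this set depends only on the values of the substitution at free
  variables.\<close>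

lemma subst_cong:
  assumes "\<And>x. x \<in> fv M \<Longrightarrow> \<theta> x = \<theta>' x"
  shows "subst \<Delta> \<theta> M = subst \<Delta> \<theta>' M"
  using assms
proof (induction M arbitrary: \<theta> \<theta>')
  case (Lam x M)
  have V: "(\<Union>z \<in> fv M - {x}. fv (\<theta> z)) = (\<Union>z \<in> fv M - {x}. fv (\<theta>' z))"
    using Lam.prems by auto
  have "subst \<Delta> (\<theta>(x := Var y)) M = subst \<Delta> (\<theta>'(x := Var y)) M" for y
    using Lam.prems by (intro Lam.IH) auto
  then show ?case by (simp add: V)
next
  case (App M N)
  have "subst \<Delta> \<theta> M = subst \<Delta> \<theta>' M" "subst \<Delta> \<theta> N = subst \<Delta> \<theta>' N"
    using App.prems by (auto intro: App.IH)
  then show ?case by simp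
qed simp_all

text \<open>Again literal, since a binder is renamed only to prevent a capture and the identity
  substitution captures nothing.\<close>

lemma subst_Var [simp]: "subst \<Delta> Var M = M"
  by (induction M) (auto simp: Let_def)

lemma has_type_subst:
  assumes "type_env \<Delta>" "has_type \<Delta> S M \<sigma>" "\<And>x. x \<in> fv M \<Longrightarrow> has_type \<Delta> S (\<theta> x) (\<Delta> x)"
  shows "has_type \<Delta> S (subst \<Delta> \<theta> M) \<sigma>"
  using assms(2,3)
proof (induction arbitrary: \<theta>)
  case (Lam M \<rho> x)
  from assms(1) obtain y where y: "subst \<Delta> \<theta> (Lam x M) = Lam y (subst \<Delta> (\<theta>(x := Var y)) M)"
    "\<Delta> y = \<Delta> x"
    by (rule subst_Lam_fresh[of \<Delta> \<theta> x M]) auto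
  have "has_type \<Delta> S (subst \<Delta> (\<theta>(x := Var y)) M) \<rho>"
    using Lam.prems y(2)[symmetric] by (intro Lam.IH) (auto intro: has_type.Var)
  then show ?case unfolding y(1) using Lam.hyps(2) y(2) has_type.Lam by metis
qed (auto intro: has_type.intros)

lemma no_logical_subst:
  assumes "no_logical M" "\<And>x. x \<in> fv M \<Longrightarrow> no_logical (\<theta> x)"
  shows "no_logical (subst \<Delta> \<theta> M)"
  using assms by (induction M arbitrary: \<theta>) (auto simp: Let_def)

lemma atom_subst:
  assumes "type_env \<Delta>" "atom \<Delta> S M" "\<And>x. x \<in> fv M \<Longrightarrow> has_type \<Delta> S (\<theta> x) (\<Delta> x)"
    "\<And>x. x \<in> fv M \<Longrightarrow> no_logical (\<theta> x)"
  shows "atom \<Delta> S (subst \<Delta> \<theta> M)"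
  using assms by (auto simp: atom_def intro: has_type_subst no_logical_subst)

text \<open>Iterated substitutions are not composed into a single one: composition holds only up to
  renaming of bound variables, whereas a list of substitutions can be pushed under a binder
  literally.\<close>

abbreviation substs where "substs \<Delta> \<equiv> fold (subst \<Delta>)"

lemma substs_App [simp]: "substs \<Delta> \<theta>s (App M N) = App (substs \<Delta> \<theta>s M) (substs \<Delta> \<theta>s N)"
  by (induction \<theta>s arbitrary: M N) auto

lemma substs_Const [simp]: "substs \<Delta> \<theta>s (Const c) = Const c"
  by (induction \<theta>s) auto

lemma fv_substs:
  assumes "type_env \<Delta>"
  shows "fv (substs \<Delta> \<theta>s M) = (\<Union>z \<in> fv M. fv (substs \<Delta> \<theta>s (Var z)))"
  by (induction \<theta>s rule: rev_induct) (auto simp: fv_subst[OF assms])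

text \<open>Each substitution of the list is updated at the current name of the binder, sending it
  to its next name. The images of the other free variables do not contain the binder, so this update
  leaves them as they are under \<open>\<theta>s\<close>. The freshness of \<open>y\<close> is the
  invariant that keeps the induction going.\<close>

lemma substs_Lam:
  assumes "type_env \<Delta>"
  shows "\<exists>y \<theta>s'. substs \<Delta> \<theta>s (Lam x M) = Lam y (substs \<Delta> \<theta>s' M) \<and>
    substs \<Delta> \<theta>s' (Var x) = Var y \<and>
    (\<forall>z \<in> fv M - {x}. substs \<Delta> \<theta>s' (Var z) = substs \<Delta> \<theta>s (Var z) \<and>
       y \<notin> fv (substs \<Delta> \<theta>s (Var z)))"
proof (induction \<theta>s rule: rev_induct)
  case Nil
  show ?case by (intro exI[of _ x] exI[of _ "[]"]) auto
next
  case (snoc \<theta> \<theta>s)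
  then obtain y \<theta>s' where IH: "substs \<Delta> \<theta>s (Lam x M) = Lam y (substs \<Delta> \<theta>s' M)"
    "substs \<Delta> \<theta>s' (Var x) = Var y"
    "\<And>z. z \<in> fv M - {x} \<Longrightarrow> substs \<Delta> \<theta>s' (Var z) = substs \<Delta> \<theta>s (Var z)"
    "\<And>z. z \<in> fv M - {x} \<Longrightarrow> y \<notin> fv (substs \<Delta> \<theta>s (Var z))"
    by blast
  define M' where "M' = substs \<Delta> \<theta>s' M"
  from assms obtain y' where y': "subst \<Delta> \<theta> (Lam y M') = Lam y' (subst \<Delta> (\<theta>(y := Var y')) M')"
    "\<And>z. z \<in> fv M' - {y} \<Longrightarrow> y' \<notin> fv (\<theta> z)"
    by (rule subst_Lam_fresh[of \<Delta> \<theta> y M']) auto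
  \<comment> \<open>The update at \<open>y\<close> is invisible here because \<open>y\<close> is not
    free in the image of \<open>z\<close>.\<close>
  have "subst \<Delta> (\<theta>(y := Var y')) (substs \<Delta> \<theta>s' (Var z)) = subst \<Delta> \<theta> (substs \<Delta> \<theta>s (Var z))"
    if "z \<in> fv M - {x}" for z
    using IH(3,4)[OF that] by (auto intro: subst_cong)
  moreover have "y' \<notin> fv (subst \<Delta> \<theta> (substs \<Delta> \<theta>s (Var z)))" if z: "z \<in> fv M - {x}" for z
  proof -
    have "fv (substs \<Delta> \<theta>s (Var z)) \<subseteq> fv M' - {y}"
      using IH(3,4)[OF z] z fv_substs[OF assms, of \<theta>s' M] by (auto simp: M'_def)
    with y'(2) show ?thesis by (auto simp: fv_subst[OF assms])
  qed
  ultimately show ?case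
    using IH(1,2) y'(1)
    by (intro exI[of _ y'] exI[of _ "\<theta>s' @ [\<theta>(y := Var y')]"]) (auto simp: M'_def)
qed

section \<open>Application spines and evaluation in the background structure\<close>

lemma vs_apps [simp]: "vs (apps M Ns) = vs M \<union> (\<Union>N \<in> set Ns. vs N)"
  by (induction Ns arbitrary: M) auto

lemma cs_apps [simp]: "cs (apps M Ns) = cs M \<union> (\<Union>N \<in> set Ns. cs N)"
  by (induction Ns arbitrary: M) auto

lemma no_lam_apps [simp]: "no_lam (apps M Ns) \<longleftrightarrow> no_lam M \<and> (\<forall>N \<in> set Ns. no_lam N)"
  by (induction Ns arbitrary: M) auto

lemma fo_val_apps: "fo_val A \<alpha> (apps M Ns) as = fo_val A \<alpha> M (map (\<lambda>N. fo_val A \<alpha> N []) Ns @ as)"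
  by (induction Ns arbitrary: M) auto

lemma fo_holds_apps:
  "fo_holds A \<alpha> (apps M Ns) as = fo_holds A \<alpha> M (map (\<lambda>N. fo_val A \<alpha> N []) Ns @ as)"
  by (induction Ns arbitrary: M) auto

lemma fo_val_cong: "(\<And>x. x \<in> vs M \<Longrightarrow> \<alpha> x = \<alpha>' x) \<Longrightarrow> fo_val A \<alpha> M as = fo_val A \<alpha>' M as"
  by (induction M arbitrary: as) auto

lemma fo_holds_cong:
  "(\<And>x. x \<in> vs M \<Longrightarrow> \<alpha> x = \<alpha>' x) \<Longrightarrow> fo_holds A \<alpha> M as = fo_holds A \<alpha>' M as"
proof (induction M arbitrary: as)
  case (App M N)
  then show ?case using fo_val_cong[of N \<alpha> \<alpha>'] by auto
qed auto

lemma arity_foldr_Arr: "arity (foldr Arr \<sigma>s \<sigma>) = length \<sigma>s + arity \<sigma>"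
  by (induction \<sigma>s) auto

lemma target_foldr_Arr: "target (foldr Arr \<sigma>s \<sigma>) = target \<sigma>"
  by (induction \<sigma>s) auto

section \<open>Derivations preserve clauses\<close>

lemma variant_refl: "variant \<Delta> C C"
  unfolding variant_def by (intro exI[of _ id], cases C) (auto simp: subst_Var[abs_def])

lemma HoCHC_variant:
  assumes "type_env \<Delta>" "HoCHC \<Delta> S S' C" "variant \<Delta> C C'"
  shows "HoCHC \<Delta> S S' C'"
proof -
  from assms(3) obtain \<pi> where \<pi>: "inj_on \<pi> (fv_clause C)"
    "\<forall>x \<in> fv_clause C. \<Delta> (\<pi> x) = \<Delta> x" "C' = rename_clause \<Delta> \<pi> C"
    by (auto simp: variant_def)
  have at: "atom \<Delta> S' (subst \<Delta> (\<lambda>x. Var (\<pi> x)) M)"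
    if "atom \<Delta> S' M" "fv M \<subseteq> fv_clause C" for M
  proof (rule atom_subst[OF assms(1) that(1)])
    show "has_type \<Delta> S' (Var (\<pi> x)) (\<Delta> x)" if "x \<in> fv M" for x
      using that \<open>fv M \<subseteq> fv_clause C\<close> \<pi>(2) has_type.Var[of \<Delta> S' "\<pi> x"] by (metis subsetD)
  qed simp
  show ?thesis
  proof (cases C)
    case (Goal G)
    then show ?thesis using assms(2) \<pi>(3) by (auto intro!: at)
  next
    case (Definite G R xs)
    have R: "has_type \<Delta> S' (Const R) (foldr Arr (map \<Delta> xs) Omicron)"
      using assms(2) Definite by (auto intro: has_type.Const has_type_apps_VarsD)
    have "list_all2 (has_type \<Delta> S') (map Var (map \<pi> xs)) (map \<Delta> xs)"
    proof -
      have "has_type \<Delta> S' (Var (\<pi> x)) (\<Delta> x)" if "x \<in> set xs" for x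
        using that \<pi>(2) Definite has_type.Var[of \<Delta> S' "\<pi> x"] by (metis UnCI fv_clause.simps(2))
      then show ?thesis by (auto simp: list_all2_conv_all_nth)
    qed
    then have "has_type \<Delta> S' (apps (Const R) (map Var (map \<pi> xs))) Omicron"
      by (rule has_type_appsI[OF R])
    moreover have "distinct (map \<pi> xs)"
      using assms(2) Definite \<pi>(1) by (auto simp: distinct_map intro: inj_on_subset)
    ultimately show ?thesis
      using assms(2) \<pi>(3) Definite by (auto intro!: at)
  qed
qed

text \<open>Subject reduction for the rules: resolution and \<beta>-reduction substitute terms of
  the right types that contain no logical symbols. This ensures that the set reached by a refutation
  consists of HoCHCs.\<close>

lemma HoCHC_derivable:
  assumes "type_env \<Delta>" "\<forall>C \<in> \<Gamma>. HoCHC \<Delta> S S' C" "derivable \<Delta> S S' A \<Gamma> C"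
  shows "HoCHC \<Delta> S S' C"
  using assms(3)
proof cases
  case (resolution C' R Ms G D G' xs)
  have 1: "HoCHC \<Delta> S S' (Goal (add_mset (apps (Const R) Ms) G))"
    using HoCHC_variant assms resolution by blast
  have 2: "HoCHC \<Delta> S S' (Definite G' R xs)"
    using HoCHC_variant assms resolution by blast
  have at: "atom \<Delta> S' (apps (Const R) Ms)" using 1 by simp
  then obtain \<sigma>s where \<sigma>s: "has_type \<Delta> S' (Const R) (foldr Arr \<sigma>s Omicron)"
    "list_all2 (has_type \<Delta> S') Ms \<sigma>s"
    using has_type_appsD[of \<Delta> S' "Const R" Ms Omicron] by (auto simp: atom_def)
  have "S' R = Some (foldr Arr (map \<Delta> xs) Omicron)"
    using 2 by (auto intro: has_type_apps_VarsD)
  \<comment> \<open>The type of \<open>R\<close> determines the argument types both in the resolved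
    atom and in the head of the definite clause.\<close>
  with \<sigma>s(1) have "\<sigma>s = map \<Delta> xs"
    by (auto elim!: has_type_ConstE dest: foldr_Arr_Omicron_inj)
  with \<sigma>s(2) have ty: "has_type \<Delta> S' (Ms ! i) (\<Delta> (xs ! i))" if "i < length xs" for i
    using that by (auto simp: list_all2_conv_all_nth)
  have \<theta>: "has_type \<Delta> S' (subst_list xs Ms x) (\<Delta> x) \<and> no_logical (subst_list xs Ms x)" for x
  proof (cases "map_of (zip xs Ms) x")
    case None
    then show ?thesis by (auto simp: subst_list_def intro: has_type.Var)
  next
    case (Some M)
    then obtain i where "i < length xs" "x = xs ! i" "M = Ms ! i"
      using map_of_SomeD[OF Some] by (auto simp: in_set_zip)
    with ty Some at resolution(6) show ?thesis by (auto simp: subst_list_def atom_def)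
  qed
  show ?thesis
    unfolding resolution(1) using 1 2 \<theta> by (auto intro!: atom_subst[OF assms(1)])
next
  case (beta C' x L M Ns G)
  have 1: "HoCHC \<Delta> S S' (Goal (add_mset (apps (App (Lam x L) M) Ns) G))"
    using HoCHC_variant assms beta by blast
  then have at: "atom \<Delta> S' (apps (App (Lam x L) M) Ns)" by simp
  then obtain \<sigma>s where \<sigma>s: "has_type \<Delta> S' (App (Lam x L) M) (foldr Arr \<sigma>s Omicron)"
    "list_all2 (has_type \<Delta> S') Ns \<sigma>s"
    using has_type_appsD[of \<Delta> S' "App (Lam x L) M" Ns Omicron] by (auto simp: atom_def)
  have L: "has_type \<Delta> S' L (foldr Arr \<sigma>s Omicron)" and M: "has_type \<Delta> S' M (\<Delta> x)"
    using \<sigma>s(1) by (auto elim!: has_type_AppE has_type_LamE)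
  have "has_type \<Delta> S' (subst \<Delta> (Var(x := M)) L) (foldr Arr \<sigma>s Omicron)"
    using L M by (intro has_type_subst[OF assms(1)]) (auto intro: has_type.Var)
  then have "has_type \<Delta> S' (apps (subst \<Delta> (Var(x := M)) L) Ns) Omicron"
    using \<sigma>s(2) by (rule has_type_appsI)
  moreover have "no_logical (subst \<Delta> (Var(x := M)) L)"
    using at by (intro no_logical_subst) (auto simp: atom_def)
  ultimately show ?thesis
    unfolding beta(1) using 1 by (auto simp: atom_def)
next
  case constraint_refutation
  then show ?thesis by simp
qed

lemma HoCHC_steps:
  assumes "type_env \<Delta>" "(step \<Delta> S S' A)\<^sup>*\<^sup>* \<Gamma> \<Gamma>'" "\<forall>C \<in> \<Gamma>. HoCHC \<Delta> S S' C"
  shows "\<forall>C \<in> \<Gamma>'. HoCHC \<Delta> S S' C"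
  using assms(2,3)
proof induction
  case (step \<Gamma>' \<Gamma>'')
  from step.hyps(2) obtain C where C: "derivable \<Delta> S S' A \<Gamma>' C" "\<Gamma>'' = \<Gamma>' \<union> {C}"
    unfolding step_def by blast
  have "HoCHC \<Delta> S S' C"
    using assms(1) step.IH[OF step.prems] C(1) by (rule HoCHC_derivable)
  with step.IH[OF step.prems] C(2) show ?case by blast
qed

section \<open>Denotations\<close>

lemma is_ty_ArrD: "is_ty (\<sigma>\<^sub>1 \<rightarrow>\<^sub>t \<sigma>\<^sub>2) \<Longrightarrow> is_ty \<sigma>\<^sub>2"
  by (auto simp: is_ty_def)

lemma arg_ty_is_ty: "arg_ty \<tau> \<Longrightarrow> is_ty \<tau>"
  by (auto simp: arg_ty_def is_ty_def)

lemma has_type_is_ty: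
  assumes "type_env \<Delta>" "signature S" "has_type \<Delta> S M \<sigma>"
  shows "is_ty \<sigma>"
  using assms(3)
proof induction
  case (Var x)
  then show ?case using assms(1) by (auto simp: type_env_def intro: arg_ty_is_ty)
next
  case (Const c \<sigma>)
  then show ?case using assms(2) by (auto simp: signature_def)
next
  case (App M\<^sub>1 \<sigma>\<^sub>1 \<sigma>\<^sub>2 M\<^sub>2)
  then show ?case by (blast dest: is_ty_ArrD)
next
  case (Lam M \<rho> x)
  then show ?case using assms(1) by (auto simp: type_env_def is_ty_def arg_ty_def)
qed (auto simp: is_ty_def arg_ty_def)

lemma preframe_ap:
  assumes "preframe H" "is_ty (\<sigma>\<^sub>1 \<rightarrow>\<^sub>t \<sigma>\<^sub>2)" "f \<in> carr H (\<sigma>\<^sub>1 \<rightarrow>\<^sub>t \<sigma>\<^sub>2)" "a \<in> carr H \<sigma>\<^sub>1"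
  shows "ap H f a \<in> carr H \<sigma>\<^sub>2"
  using assms unfolding preframe_def by blast

lemma preframe_ext:
  assumes "preframe H" "is_ty (\<sigma>\<^sub>1 \<rightarrow>\<^sub>t \<sigma>\<^sub>2)" "f \<in> carr H (\<sigma>\<^sub>1 \<rightarrow>\<^sub>t \<sigma>\<^sub>2)" "g \<in> carr H (\<sigma>\<^sub>1 \<rightarrow>\<^sub>t \<sigma>\<^sub>2)"
    "\<And>a. a \<in> carr H \<sigma>\<^sub>1 \<Longrightarrow> ap H f a = ap H g a"
  shows "f = g"
  using assms unfolding preframe_def by blast

lemma preframe_Omicron: "preframe H \<Longrightarrow> carr H Omicron = {tv H False, tv H True}"
  unfolding preframe_def by blast

lemma preframe_tv:
  assumes "preframe H"
  shows "tv H b = tv H True \<longleftrightarrow> b"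
proof -
  have "tv H False \<noteq> tv H True" using assms unfolding preframe_def by (elim conjE)
  then show ?thesis by (cases b) simp_all
qed

lemma tv_in_carr: "preframe H \<Longrightarrow> tv H b \<in> carr H Omicron"
  by (cases b) (auto simp: preframe_Omicron)

lemma is_ty_connective: "is_ty (Omicron \<rightarrow>\<^sub>t Omicron \<rightarrow>\<^sub>t Omicron)" "is_ty (Omicron \<rightarrow>\<^sub>t Omicron)"
  by (auto simp: is_ty_def)

text \<open>Extensionality is applied twice, over a domain consisting of the two truth values. Hence
  the descriptions that interpret \<open>Con\<close> and \<open>Dis\<close> have a unique
  referent.\<close>

lemma binary_connective_unique:
  assumes "preframe H" "f \<in> carr H (Omicron \<rightarrow>\<^sub>t Omicron \<rightarrow>\<^sub>t Omicron)"
    "g \<in> carr H (Omicron \<rightarrow>\<^sub>t Omicron \<rightarrow>\<^sub>t Omicron)"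
    "\<And>a b. ap H (ap H f (tv H a)) (tv H b) = ap H (ap H g (tv H a)) (tv H b)"
  shows "f = g"
proof (rule preframe_ext[OF assms(1) is_ty_connective(1) assms(2,3)])
  fix a assume a: "a \<in> carr H Omicron"
  show "ap H f a = ap H g a"
  proof (rule preframe_ext[OF assms(1) is_ty_connective(2)])
    show "ap H f a \<in> carr H (Omicron \<rightarrow>\<^sub>t Omicron)" "ap H g a \<in> carr H (Omicron \<rightarrow>\<^sub>t Omicron)"
      using preframe_ap[OF assms(1) is_ty_connective(1)] assms(2,3) a by blast+
    show "ap H (ap H f a) b = ap H (ap H g a) b" if "b \<in> carr H Omicron" for b
      using a that assms(4) preframe_Omicron[OF assms(1)] by auto
  qed
qed

lemma is_min_The:
  assumes "preframe H"
  shows "is_min H (THE f. is_min H f)"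
proof (rule theI', rule ex_ex1I)
  show "\<exists>f. is_min H f" using assms unfolding preframe_def by (elim conjE)
  show "f = g" if "is_min H f" "is_min H g" for f g
    by (rule binary_connective_unique[OF assms]) (use that in \<open>auto simp: is_min_def\<close>)
qed

lemma is_max_The:
  assumes "preframe H"
  shows "is_max H (THE f. is_max H f)"
proof (rule theI', rule ex_ex1I)
  show "\<exists>f. is_max H f" using assms unfolding preframe_def by (elim conjE)
  show "f = g" if "is_max H f" "is_max H g" for f g
    by (rule binary_connective_unique[OF assms]) (use that in \<open>auto simp: is_max_def\<close>)
qed

lemma is_E_The:
  assumes "preframe H" "arg_ty \<tau>"
  shows "is_E H \<tau> (THE e. is_E H \<tau> e)"
proof (rule theI')
  have "\<forall>\<tau>. arg_ty \<tau> \<longrightarrow> (\<exists>e. is_E H \<tau> e)"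
    using assms(1) unfolding preframe_def by (elim conjE)
  then have "\<exists>e. is_E H \<tau> e" using assms(2) by blast
  moreover have "e = e'" if "is_E H \<tau> e" "is_E H \<tau> e'" for e e'
  proof (rule preframe_ext[OF assms(1), of "\<tau> \<rightarrow>\<^sub>t Omicron" Omicron])
    show "is_ty ((\<tau> \<rightarrow>\<^sub>t Omicron) \<rightarrow>\<^sub>t Omicron)"
      using assms(2) by (auto simp: is_ty_def arg_ty_def)
  qed (use that in \<open>simp_all add: is_E_def\<close>)
  ultimately show "\<exists>!e. is_E H \<tau> e" by blast
qed

text \<open>If the function is represented, extensionality makes its representative unique;
  otherwise nonemptiness of the carrier supplies the arbitrary element.\<close>

lemma lam_el_in_carr:
  assumes "preframe H" "is_ty (\<sigma>\<^sub>1 \<rightarrow>\<^sub>t \<sigma>\<^sub>2)"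
  shows "lam_el H \<sigma>\<^sub>1 \<sigma>\<^sub>2 F \<in> carr H (\<sigma>\<^sub>1 \<rightarrow>\<^sub>t \<sigma>\<^sub>2)"
proof (cases "\<exists>f \<in> carr H (\<sigma>\<^sub>1 \<rightarrow>\<^sub>t \<sigma>\<^sub>2). \<forall>a \<in> carr H \<sigma>\<^sub>1. ap H f a = F a")
  case True
  let ?P = "\<lambda>f. f \<in> carr H (\<sigma>\<^sub>1 \<rightarrow>\<^sub>t \<sigma>\<^sub>2) \<and> (\<forall>a \<in> carr H \<sigma>\<^sub>1. ap H f a = F a)"
  have "\<exists>!f. ?P f"
  proof (rule ex_ex1I)
    show "\<exists>f. ?P f" using True by blast
    show "f = g" if "?P f" "?P g" for f g
      by (rule preframe_ext[OF assms]) (use that in auto)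
  qed
  then have "?P (THE f. ?P f)" by (rule theI')
  then show ?thesis using True by (simp add: lam_el_def)
next
  case False
  have "\<forall>\<sigma>. is_ty \<sigma> \<longrightarrow> carr H \<sigma> \<noteq> {}"
    using assms(1) unfolding preframe_def by (elim conjE)
  then have "\<exists>f. f \<in> carr H (\<sigma>\<^sub>1 \<rightarrow>\<^sub>t \<sigma>\<^sub>2)" using assms(2) by blast
  then have "(SOME f. f \<in> carr H (\<sigma>\<^sub>1 \<rightarrow>\<^sub>t \<sigma>\<^sub>2)) \<in> carr H (\<sigma>\<^sub>1 \<rightarrow>\<^sub>t \<sigma>\<^sub>2)" by (rule someI_ex)
  then show ?thesis unfolding lam_el_def using False by (simp only: if_False)
qed

lemma denot_in_carr:
  assumes "preframe H" "type_env \<Delta>" "signature S" "struct S H B"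
    and "has_type \<Delta> S M \<sigma>" "valuation \<Delta> H \<alpha>"
  shows "denot \<Delta> S H B M \<alpha> \<in> carr H \<sigma>"
  using assms(5,6)
proof (induction arbitrary: \<alpha>)
  case (Var x)
  then show ?case by (simp add: valuation_def)
next
  case (Const c \<sigma>)
  then show ?case using assms(4) by (simp add: struct_def)
next
  case (App M\<^sub>1 \<sigma>\<^sub>1 \<sigma>\<^sub>2 M\<^sub>2)
  have "M\<^sub>1 \<noteq> Neg" using App.hyps(1) by (auto elim: has_type_NegE)
  moreover have "is_ty (\<sigma>\<^sub>1 \<rightarrow>\<^sub>t \<sigma>\<^sub>2)" using has_type_is_ty[OF assms(2,3) App.hyps(1)] .
  ultimately show ?case using App.IH App.prems preframe_ap[OF assms(1)] by simp
next
  case (Lam M \<rho> x)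
  have "(THE \<rho>. has_type \<Delta> S M \<rho>) = \<rho>"
    using Lam.hyps(1) has_type_unique by (metis the_equality)
  moreover have "is_ty (\<Delta> x \<rightarrow>\<^sub>t \<rho>)"
    using has_type_is_ty[OF assms(2,3) has_type.Lam[OF Lam.hyps]] .
  ultimately show ?case using lam_el_in_carr[OF assms(1)] by simp
next
  case Con
  then show ?case using is_min_The[OF assms(1)] by (simp add: is_min_def)
next
  case Dis
  then show ?case using is_max_The[OF assms(1)] by (simp add: is_max_def)
next
  case (Neg M)
  then show ?case using tv_in_carr[OF assms(1)] by simp
next
  case (Ex \<tau>)
  then show ?case using is_E_The[OF assms(1)] by (simp add: is_E_def)
qed

lemma denot_cong:
  "(\<And>x. x \<in> fv M \<Longrightarrow> \<alpha> x = \<alpha>' x) \<Longrightarrow> denot \<Delta> S H B M \<alpha> = denot \<Delta> S H B M \<alpha>'"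
proof (induction M arbitrary: \<alpha> \<alpha>')
  case (App M N)
  have "denot \<Delta> S H B M \<alpha> = denot \<Delta> S H B M \<alpha>'" "denot \<Delta> S H B N \<alpha> = denot \<Delta> S H B N \<alpha>'"
    using App.prems by (auto intro: App.IH)
  then show ?case by simp
next
  case (Lam x M)
  have "denot \<Delta> S H B M (\<alpha>(x := r)) = denot \<Delta> S H B M (\<alpha>'(x := r))" for r
    using Lam.prems by (intro Lam.IH) auto
  then show ?case by simp
qed simp_all

lemma denot_apps:
  "M \<noteq> Neg \<Longrightarrow> denot \<Delta> S H B (apps M Ns) \<alpha> =
     foldl (ap H) (denot \<Delta> S H B M \<alpha>) (map (\<lambda>N. denot \<Delta> S H B N \<alpha>) Ns)"
  by (induction Ns rule: rev_induct) (auto simp: apps_neq_Neg)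

lemma denot_Con:
  assumes "preframe H" "denot \<Delta> S H B M \<alpha> \<in> carr H Omicron" "denot \<Delta> S H B N \<alpha> \<in> carr H Omicron"
  shows "denot \<Delta> S H B (App (App Con M) N) \<alpha> = tv H True \<longleftrightarrow>
    denot \<Delta> S H B M \<alpha> = tv H True \<and> denot \<Delta> S H B N \<alpha> = tv H True"
proof -
  obtain a b where "denot \<Delta> S H B M \<alpha> = tv H a" "denot \<Delta> S H B N \<alpha> = tv H b"
    using assms by (auto simp: preframe_Omicron)
  then show ?thesis
    using is_min_The[OF assms(1)] by (simp add: is_min_def preframe_tv[OF assms(1)])
qed

lemma frame_beta:
  fixes S :: "'c sig"
  assumes "frame TYPE('c) \<Delta> H" "signature S" "struct S H B" "valuation \<Delta> H \<alpha>"
    "has_type \<Delta> S (Lam x M) \<sigma>" "pos_ex M" "r \<in> carr H (\<Delta> x)"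
  shows "ap H (denot \<Delta> S H B (Lam x M) \<alpha>) r = denot \<Delta> S H B M (\<alpha>(x := r))"
  using assms unfolding frame_def by (metis pos_ex.simps(3))

section \<open>Iterated abstractions and conjunctions\<close>

lemma rel_ty_foldr_Arr: "type_env \<Delta> \<Longrightarrow> rel_ty (foldr Arr (map \<Delta> xs) Omicron)"
  by (induction xs) (auto simp: type_env_def arg_ty_def)

lemma has_type_foldr_Lam:
  assumes "type_env \<Delta>" "has_type \<Delta> S F Omicron"
  shows "has_type \<Delta> S (foldr Lam xs F) (foldr Arr (map \<Delta> xs) Omicron)"
  by (induction xs) (auto intro: assms has_type.Lam rel_ty_foldr_Arr)

lemma pos_ex_foldr_Lam: "pos_ex (foldr Lam xs F) \<longleftrightarrow> pos_ex F"
  by (induction xs) auto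

text \<open>The frame condition is used once per binder; \<open>\<beta>\<close> is
  \<open>\<alpha>\<close> updated at \<open>xs\<close> by \<open>ss\<close>. Positive existential
  bodies suffice for the uses below, where the body is a conjunction of atoms.\<close>

lemma denot_foldr_Lam:
  fixes S :: "'c sig"
  assumes "frame TYPE('c) \<Delta> H" "type_env \<Delta>" "signature S" "struct S H B"
    and F: "has_type \<Delta> S F Omicron" "pos_ex F"
    and "distinct xs" "length ss = length xs" "\<forall>i < length xs. ss ! i \<in> carr H (\<Delta> (xs ! i))"
    and "valuation \<Delta> H \<alpha>"
  shows "\<exists>\<beta>. valuation \<Delta> H \<beta> \<and> (\<forall>i < length xs. \<beta> (xs ! i) = ss ! i) \<and>
    (\<forall>z. z \<notin> set xs \<longrightarrow> \<beta> z = \<alpha> z) \<and>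
    foldl (ap H) (denot \<Delta> S H B (foldr Lam xs F) \<alpha>) ss = denot \<Delta> S H B F \<beta>"
  using assms(7-10)
proof (induction xs arbitrary: ss \<alpha>)
  case Nil
  then show ?case by auto
next
  case (Cons x xs)
  from Cons.prems(2) obtain s ss' where ss: "ss = s # ss'" by (cases ss) auto
  have s: "s \<in> carr H (\<Delta> x)" and
    ss': "\<forall>i < length xs. ss' ! i \<in> carr H (\<Delta> (xs ! i))"
    using Cons.prems(3) ss by (force, force)
  have v: "valuation \<Delta> H (\<alpha>(x := s))" using Cons.prems(4) s by (auto simp: valuation_def)
  have "distinct xs" "length ss' = length xs" using Cons.prems(1,2) ss by simp_all
  from Cons.IH[OF this ss' v] obtain \<beta> where \<beta>: "valuation \<Delta> H \<beta>"
    "\<forall>i < length xs. \<beta> (xs ! i) = ss' ! i" "\<forall>z. z \<notin> set xs \<longrightarrow> \<beta> z = (\<alpha>(x := s)) z"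
    "foldl (ap H) (denot \<Delta> S H B (foldr Lam xs F) (\<alpha>(x := s))) ss' = denot \<Delta> S H B F \<beta>"
    by blast
  have t: "has_type \<Delta> S (Lam x (foldr Lam xs F)) (foldr Arr (map \<Delta> (x # xs)) Omicron)"
    using has_type_foldr_Lam[OF assms(2) F(1), of "x # xs"] by simp
  have p: "pos_ex (foldr Lam xs F)" using F(2) by (simp add: pos_ex_foldr_Lam)
  have "ap H (denot \<Delta> S H B (Lam x (foldr Lam xs F)) \<alpha>) s =
      denot \<Delta> S H B (foldr Lam xs F) (\<alpha>(x := s))"
    by (rule frame_beta[OF assms(1,3,4) Cons.prems(4) t p s])
  with \<beta>(4) have "foldl (ap H) (denot \<Delta> S H B (foldr Lam (x # xs) F) \<alpha>) ss = denot \<Delta> S H B F \<beta>"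
    by (simp add: ss del: denot.simps)
  \<comment> \<open>Distinctness guarantees that no later binder overwrites the value
    \<open>s\<close> of \<open>x\<close>.\<close>
  moreover have "\<forall>i < length (x # xs). \<beta> ((x # xs) ! i) = ss ! i"
    using \<beta>(2,3) Cons.prems(1) by (auto simp: ss nth_Cons split: nat.split)
  ultimately show ?case using \<beta>(1,3) by (intro exI[of _ \<beta>]) auto
qed

text \<open>The variable \<open>z\<close> is meant to have value 1 and stands for the empty conjunction.\<close>

definition conj_term :: "('c, 'v) trm list \<Rightarrow> 'v \<Rightarrow> ('c, 'v) trm" where
  "conj_term Ms z = foldr (\<lambda>M F. App (App Con M) F) Ms (Var z)"

lemma has_type_conj_term:
  assumes "\<Delta> z = Omicron" "\<forall>M \<in> set Ms. has_type \<Delta> S M Omicron"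
  shows "has_type \<Delta> S (conj_term Ms z) Omicron"
  using assms(2)
proof (induction Ms)
  case Nil
  then show ?case using has_type.Var[of \<Delta> S z] assms(1) by (simp add: conj_term_def)
next
  case (Cons M Ms)
  then show ?case by (auto simp: conj_term_def intro: has_type.App has_type.Con)
qed

lemma pos_ex_conj_term: "pos_ex (conj_term Ms z) \<longleftrightarrow> (\<forall>M \<in> set Ms. pos_ex M)"
  by (induction Ms) (auto simp: conj_term_def)

lemma denot_conj_term:
  assumes "preframe H" "type_env \<Delta>" "signature S" "struct S H B" "valuation \<Delta> H \<alpha>"
    "\<Delta> z = Omicron" "\<forall>M \<in> set Ms. has_type \<Delta> S M Omicron"
  shows "denot \<Delta> S H B (conj_term Ms z) \<alpha> = tv H True \<longleftrightarrow>
    \<alpha> z = tv H True \<and> (\<forall>M \<in> set Ms. denot \<Delta> S H B M \<alpha> = tv H True)"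
  using assms(7)
proof (induction Ms)
  case Nil
  then show ?case by (simp add: conj_term_def)
next
  case (Cons M Ms)
  note carr = denot_in_carr[OF assms(1-4) _ assms(5)]
  have "conj_term (M # Ms) z = App (App Con M) (conj_term Ms z)" by (simp add: conj_term_def)
  moreover have "has_type \<Delta> S (conj_term Ms z) Omicron" "has_type \<Delta> S M Omicron"
    using has_type_conj_term[of \<Delta> z] assms(6) Cons.prems by auto
  ultimately show ?case
    using denot_Con[OF assms(1) carr carr] Cons by (auto simp del: denot.simps)
qed

section \<open>Relating terms to elements of the frame\<close>

locale hochc =
  fixes \<Delta> :: "'v \<Rightarrow> ty"
    and \<Sigma> \<Sigma>' :: "'c sig"
    and A :: "('c, 'd) fo_str"
    and H :: "'d frm"
    and \<Gamma> :: "('c, 'v) clause set"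
  assumes type_env: "type_env \<Delta>"
    and fo_signature: "fo_signature \<Sigma>"
    and signature: "signature \<Sigma>'"
    and rel_extension: "rel_extension \<Sigma> \<Sigma>'"
    and complete: "complete_frame TYPE('c) \<Delta> H"
    and expands: "expands \<Sigma> A H"
    and clauses: "\<forall>C \<in> \<Gamma>. HoCHC \<Delta> \<Sigma> \<Sigma>' C"
begin

lemma frame: "frame TYPE('c) \<Delta> H"
  using complete by (simp add: complete_frame_def)

lemma preframe: "preframe H"
  using frame by (simp add: frame_def)

lemma carr_Iota: "carr H Iota = fdom A"
  using expands by (simp add: expands_def)

lemma sig_le: "\<Sigma> \<subseteq>\<^sub>m \<Sigma>'"
  using rel_extension by (simp add: rel_extension_def)

text \<open>A world is a finite set of variables in use together with a valuation of which only the
  values of individual variables in that set matter; a world is extended when resolution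
  introduces fresh variables.\<close>

definition world :: "'v set \<times> ('v \<Rightarrow> 'd) \<Rightarrow> bool" where
  "world w \<longleftrightarrow> finite (fst w) \<and> fo_valuation \<Delta> A (snd w)"

definition wle :: "'v set \<times> ('v \<Rightarrow> 'd) \<Rightarrow> 'v set \<times> ('v \<Rightarrow> 'd) \<Rightarrow> bool" where
  "wle w w' \<longleftrightarrow> fst w \<subseteq> fst w' \<and> (\<forall>x \<in> fst w. snd w x = snd w' x)"

lemma wle_refl [simp]: "wle w w"
  by (simp add: wle_def)

lemma wle_trans: "wle w w' \<Longrightarrow> wle w' w'' \<Longrightarrow> wle w w''"
  by (auto simp: wle_def)

text \<open>Quantifying over all supersets makes the notion insensitive to clauses derived along the
  way, since a derivation only ever adds clauses.\<close>

definition refutable :: "('c, 'v) trm multiset \<Rightarrow> bool" where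
  "refutable G \<longleftrightarrow> (\<forall>\<Gamma>'. insert (Goal G) \<Gamma> \<subseteq> \<Gamma>' \<longrightarrow>
     (\<exists>\<Gamma>''. (step \<Delta> \<Sigma> \<Sigma>' A)\<^sup>*\<^sup>* \<Gamma>' \<Gamma>'' \<and> empty_clause \<in> \<Gamma>''))"

text \<open>These are the atoms that constraint refutation can dispose of under the valuation of the
  world. Confining the variables of background atoms to the world makes their truth persist in
  extensions.\<close>

definition solved :: "'v set \<times> ('v \<Rightarrow> 'd) \<Rightarrow> ('c, 'v) trm \<Rightarrow> bool" where
  "solved w M \<longleftrightarrow> (\<exists>x Ms. M = apps (Var x) Ms) \<or>
     background_atom \<Delta> \<Sigma> \<Sigma>' M \<and> vs M \<subseteq> fst w \<and> fo_sat A (snd w) M"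

text \<open>A refutation ends in one constraint refutation, which needs a single valuation for all
  remaining background atoms. Here \<open>K\<close> collects the atoms that are already solved and
  stay in the goal, and \<open>w'\<close> carries that valuation as more variables receive
  values.\<close>

definition goal_ok :: "'v set \<times> ('v \<Rightarrow> 'd) \<Rightarrow> ('c, 'v) trm multiset \<Rightarrow> bool" where
  "goal_ok w G \<longleftrightarrow> (\<forall>w' K. wle w w' \<and> world w' \<and> (\<forall>M \<in># K. solved w' M) \<longrightarrow> refutable (G + K))"

text \<open>Reducibility is stated in continuation-passing style, so that the refutations of several
  atoms compose without renaming apart the variables that they introduce.\<close>

definition red :: "'v set \<times> ('v \<Rightarrow> 'd) \<Rightarrow> ('c, 'v) trm \<Rightarrow> bool" where
  "red w M \<longleftrightarrow> (\<forall>w' G. wle w w' \<and> world w' \<and> goal_ok w' G \<longrightarrow> goal_ok w' (add_mset M G))"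

definition bg_term :: "'v set \<times> ('v \<Rightarrow> 'd) \<Rightarrow> ('c, 'v) trm \<Rightarrow> 'd \<Rightarrow> bool" where
  "bg_term w t d \<longleftrightarrow> has_type \<Delta> \<Sigma> t Iota \<and> no_logical t \<and> no_lam t \<and>
     (\<forall>c \<in> cs t. \<exists>\<sigma>. \<Sigma> c = Some \<sigma> \<and> fo_ty \<sigma>) \<and> (\<forall>x \<in> vs t. \<Delta> x = Iota) \<and>
     vs t \<subseteq> fst w \<and> fo_val A (snd w) t [] = d"

text \<open>A Kripke logical relation: the arrow case ranges over extended worlds because arguments
  may contain variables introduced later. The value 0 imposes nothing at type \<open>o\<close>, as
  only true goals have to be refuted.\<close>

primrec rel :: "ty \<Rightarrow> 'v set \<times> ('v \<Rightarrow> 'd) \<Rightarrow> ('c, 'v) trm \<Rightarrow> 'd \<Rightarrow> bool" where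
  "rel Iota = bg_term"
| "rel Omicron = (\<lambda>w M d. d = tv H True \<longrightarrow> red w M)"
| "rel (\<tau> \<rightarrow>\<^sub>t \<rho>) = (\<lambda>w M f. \<forall>w' N s. wle w w' \<and> world w' \<and> s \<in> carr H \<tau> \<and> rel \<tau> w' N s \<longrightarrow>
     rel \<rho> w' (App M N) (ap H f s))"

section \<open>Refutability, and monotonicity in the world\<close>

lemma refutable_step:
  assumes "refutable G'" "\<And>\<Gamma>'. insert (Goal G) \<Gamma> \<subseteq> \<Gamma>' \<Longrightarrow> derivable \<Delta> \<Sigma> \<Sigma>' A \<Gamma>' (Goal G')"
  shows "refutable G"
  unfolding refutable_def
proof (intro allI impI)
  fix \<Gamma>' assume G: "insert (Goal G) \<Gamma> \<subseteq> \<Gamma>'"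
  have s: "step \<Delta> \<Sigma> \<Sigma>' A \<Gamma>' (\<Gamma>' \<union> {Goal G'})"
    using assms(2)[OF G] by (auto simp: step_def)
  have "insert (Goal G') \<Gamma> \<subseteq> \<Gamma>' \<union> {Goal G'}" using G by auto
  then obtain \<Gamma>'' where "(step \<Delta> \<Sigma> \<Sigma>' A)\<^sup>*\<^sup>* (\<Gamma>' \<union> {Goal G'}) \<Gamma>''" "empty_clause \<in> \<Gamma>''"
    using assms(1) unfolding refutable_def by blast
  with s show "\<exists>\<Gamma>''. (step \<Delta> \<Sigma> \<Sigma>' A)\<^sup>*\<^sup>* \<Gamma>' \<Gamma>'' \<and> empty_clause \<in> \<Gamma>''"
    by (meson converse_rtranclp_into_rtranclp)
qed

lemma refutable_solved:
  assumes "world w" "\<forall>M \<in># K. solved w M"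
  shows "refutable K"
  unfolding refutable_def
proof (intro allI impI)
  fix \<Gamma>' assume G: "insert (Goal K) \<Gamma> \<subseteq> \<Gamma>'"
  let ?P = "\<lambda>M. \<exists>x Ms. M = apps (Var x) Ms"
  have "derivable \<Delta> \<Sigma> \<Sigma>' A \<Gamma>' empty_clause"
  proof (rule constraint_refutation)
    show "Goal K \<in> \<Gamma>'" using G by simp
    \<comment> \<open>The goal is split into its atoms headed by a variable and the rest, which must
      be true background atoms.\<close>
    show "variant \<Delta> (Goal K) (Goal (filter_mset ?P K + filter_mset (\<lambda>M. \<not> ?P M) K))"
      by (metis multiset_partition variant_refl)
    show "\<forall>\<phi> \<in># filter_mset (\<lambda>M. \<not> ?P M) K. background_atom \<Delta> \<Sigma> \<Sigma>' \<phi>"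
      using assms(2) by (auto simp: solved_def)
    show "\<exists>\<alpha>. fo_valuation \<Delta> A \<alpha> \<and> (\<forall>\<phi> \<in># filter_mset (\<lambda>M. \<not> ?P M) K. fo_sat A \<alpha> \<phi>)"
      using assms by (intro exI[of _ "snd w"]) (auto simp: solved_def world_def)
  qed simp
  then have "step \<Delta> \<Sigma> \<Sigma>' A \<Gamma>' (\<Gamma>' \<union> {empty_clause})" by (auto simp: step_def)
  then show "\<exists>\<Gamma>''. (step \<Delta> \<Sigma> \<Sigma>' A)\<^sup>*\<^sup>* \<Gamma>' \<Gamma>'' \<and> empty_clause \<in> \<Gamma>''" by blast
qed

lemma solved_mono:
  assumes "solved w M" "wle w w'"
  shows "solved w' M"
proof (cases "\<exists>x Ms. M = apps (Var x) Ms")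
  case True
  then show ?thesis by (simp add: solved_def)
next
  case False
  then have M: "background_atom \<Delta> \<Sigma> \<Sigma>' M" "vs M \<subseteq> fst w" "fo_sat A (snd w) M"
    using assms(1) by (auto simp: solved_def)
  have "fo_holds A (snd w) M [] = fo_holds A (snd w') M []"
    using M(2) assms(2) by (intro fo_holds_cong) (auto simp: wle_def)
  with M assms(2) show ?thesis by (auto simp: solved_def fo_sat_def wle_def)
qed

lemma goal_ok_mono: "goal_ok w G \<Longrightarrow> wle w w' \<Longrightarrow> goal_ok w' G"
  unfolding goal_ok_def by (blast intro: wle_trans)

lemma red_mono: "red w M \<Longrightarrow> wle w w' \<Longrightarrow> red w' M"
  unfolding red_def by (blast intro: wle_trans)

lemma redD: "red w M \<Longrightarrow> wle w w' \<Longrightarrow> world w' \<Longrightarrow> goal_ok w' G \<Longrightarrow> goal_ok w' (add_mset M G)"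
  unfolding red_def by blast

lemma rel_ArrD:
  "rel (\<tau> \<rightarrow>\<^sub>t \<rho>) w M f \<Longrightarrow> wle w w' \<Longrightarrow> world w' \<Longrightarrow> s \<in> carr H \<tau> \<Longrightarrow> rel \<tau> w' N s \<Longrightarrow>
    rel \<rho> w' (App M N) (ap H f s)"
  unfolding rel.simps by blast

lemma sat_Neg: "sat \<Delta> \<Sigma>' H B \<alpha> (App Neg M) \<longleftrightarrow> denot \<Delta> \<Sigma>' H B M \<alpha> \<noteq> tv H True"
  by (simp add: sat_def preframe_tv[OF preframe])

text \<open>A solved atom is left in the goal until the final constraint refutation.\<close>

lemma red_solved:
  assumes "solved w M"
  shows "red w M"
  unfolding red_def goal_ok_def
proof (intro allI impI, elim conjE)
  fix w' G w'' K
  assume G: "\<forall>w'' K. wle w' w'' \<and> world w'' \<and> (\<forall>M \<in># K. solved w'' M) \<longrightarrow> refutable (G + K)"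
    and w: "wle w w'" "wle w' w''" "world w''" and K: "\<forall>M \<in># K. solved w'' M"
  \<comment> \<open>The atom moves into the multiset of solved atoms with which the rest of the goal
    is refuted.\<close>
  have "\<forall>N \<in># add_mset M K. solved w'' N"
    using K solved_mono[OF assms wle_trans[OF w(1,2)]] by simp
  with G w have "refutable (G + add_mset M K)" by blast
  then show "refutable (add_mset M G + K)" by simp
qed

lemma goal_ok_add:
  assumes "goal_ok w G" "world w" "\<forall>M \<in># G'. red w M"
  shows "goal_ok w (G' + G)"
  using assms(3)
proof (induction G')
  case empty
  then show ?case using assms(1) by simp
next
  case (add M G')
  then have "goal_ok w (G' + G)" "red w M" by simp_all
  then show ?case using redD[of w M w "G' + G"] assms(2) by simp
qed

lemma bg_term_mono:
  assumes "bg_term w t d" "wle w w'"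
  shows "bg_term w' t d"
proof -
  have "fo_val A (snd w) t [] = fo_val A (snd w') t []"
    using assms by (intro fo_val_cong) (auto simp: wle_def bg_term_def)
  then show ?thesis using assms by (auto simp: wle_def bg_term_def)
qed

text \<open>No induction on types: the relations at \<open>o\<close> and at arrow types quantify
  over extensions already, and background terms mention only variables on which the two worlds
  agree.\<close>

lemma rel_mono:
  assumes "rel \<sigma> w M d" "wle w w'"
  shows "rel \<sigma> w' M d"
proof (cases \<sigma>)
  case Iota
  then show ?thesis using assms bg_term_mono by simp
next
  case Omicron
  then show ?thesis using assms red_mono unfolding Omicron rel.simps by blast
next
  case (Arr \<tau> \<rho>)
  then show ?thesis using assms wle_trans unfolding Arr rel.simps by blast
qed

section \<open>Closure properties of the logical relation\<close>

lemma red_Var: "red w (apps (Var x) Ms)"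
  by (rule red_solved) (auto simp: solved_def)

text \<open>Arguments are collected in a spine until type \<open>o\<close> is reached, where the
  atom is headed by a variable and therefore solved. Hence the element \<open>d\<close> is
  arbitrary.\<close>

lemma rel_Var:
  assumes "rel_ty \<rho>"
  shows "rel \<rho> w (apps (Var y) Ms) d"
  using assms
proof (induction \<rho> arbitrary: w Ms d)
  case Omicron
  show ?case using red_Var by simp
next
  case (Arr \<tau> \<rho> w Ms d)
  have "rel \<rho> w' (App (apps (Var y) Ms) N) e" for w' N e
    using Arr.IH(2)[of w' "Ms @ [N]" e] Arr.prems by simp
  then show ?case by simp
qed simp

text \<open>Arguments are collected until the term is an atom; there one application of the
  \<beta>-rule turns a goal containing the redex into the one containing the contractum.\<close>

lemma rel_beta:
  assumes "rel_ty \<rho>" "rel \<rho> w (apps (subst \<Delta> (Var(x := N)) L) Ns) d"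
  shows "rel \<rho> w (apps (App (Lam x L) N) Ns) d"
  using assms
proof (induction \<rho> arbitrary: w Ns d)
  case Omicron
  let ?M = "apps (App (Lam x L) N) Ns" and ?M' = "apps (subst \<Delta> (Var(x := N)) L) Ns"
  have ref: "refutable (add_mset ?M G)" if "refutable (add_mset ?M' G)" for G
    by (rule refutable_step[OF that])
      (rule beta[where C = "Goal (add_mset ?M G)"], simp, rule variant_refl)
  have "red w ?M" if r: "red w ?M'"
    unfolding red_def goal_ok_def
  proof (intro allI impI, elim conjE)
    fix w' G w'' K
    assume G: "\<forall>w'' K. wle w' w'' \<and> world w'' \<and> (\<forall>M \<in># K. solved w'' M) \<longrightarrow> refutable (G + K)"
      and w: "wle w w'" "world w'" "wle w' w''" "world w''" and K: "\<forall>M \<in># K. solved w'' M"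
    from G have "goal_ok w' G" unfolding goal_ok_def .
    with r w have "goal_ok w' (add_mset ?M' G)" unfolding red_def by blast
    with w K have "refutable (add_mset ?M' G + K)" unfolding goal_ok_def by blast
    then show "refutable (add_mset ?M G + K)" using ref[of "G + K"] by simp
  qed
  then show ?case using Omicron(2) unfolding rel.simps by blast
next
  case (Arr \<tau> \<rho>)
  show ?case
    unfolding rel.simps
  proof (intro allI impI, elim conjE)
    fix w' P s assume a: "wle w w'" "world w'" "s \<in> carr H \<tau>" "rel \<tau> w' P s"
    have "rel \<rho> w' (apps (subst \<Delta> (Var(x := N)) L) (Ns @ [P])) (ap H d s)"
      using rel_ArrD[OF Arr.prems(2) a] by (simp del: fun_upd_apply)
    then have "rel \<rho> w' (apps (App (Lam x L) N) (Ns @ [P])) (ap H d s)"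
      using Arr.IH(2)[of w' "Ns @ [P]" "ap H d s"] Arr.prems(1) by (simp del: fun_upd_apply)
    then show "rel \<rho> w' (App (apps (App (Lam x L) N) Ns) P) (ap H d s)" by simp
  qed
qed simp

text \<open>At \<open>o\<close> the bound is 1 only if some member of \<open>X\<close> is 1, and
  that member already forces reducibility. At arrow types the bound is computed pointwise, so the
  claim descends to the result type.\<close>

lemma rel_lub:
  assumes "rel_ty \<rho>" "\<forall>d \<in> X. rel \<rho> w M d" "pointwise_lub H \<rho> X u"
  shows "rel \<rho> w M u"
  using assms
proof (induction \<rho> arbitrary: w M X u)
  case Omicron
  then show ?case using preframe_tv[OF preframe] by auto
next
  case (Arr \<tau> \<rho>)
  show ?case
    unfolding rel.simps
  proof (intro allI impI, elim conjE)
    fix w' N s assume a: "wle w w'" "world w'" "s \<in> carr H \<tau>" "rel \<tau> w' N s"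
    show "rel \<rho> w' (App M N) (ap H u s)"
    proof (rule Arr.IH(2))
      show "\<forall>d \<in> (\<lambda>f. ap H f s) ` X. rel \<rho> w' (App M N) d" using Arr.prems(2) a rel_ArrD by blast
    qed (use Arr.prems a in auto)
  qed
qed simp

text \<open>The upper bound half of being a least upper bound, in uncurried form:
  \<open>pointwise_lub\<close> refers to no order, so the property is recovered by evaluating one
  argument at a time.\<close>

lemma pointwise_lub_upper:
  assumes "pointwise_lub H (foldr Arr (map \<Delta> xs) Omicron) X u" "f \<in> X"
    "valuation \<Delta> H \<alpha>" "foldl (ap H) f (map \<alpha> xs) = tv H True"
  shows "foldl (ap H) u (map \<alpha> xs) = tv H True"
  using assms
proof (induction xs arbitrary: X u f)
  case Nil
  then show ?case by auto
next
  case (Cons x xs)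
  have "\<alpha> x \<in> carr H (\<Delta> x)" using assms(3) by (simp add: valuation_def)
  with Cons.prems(1) have
    "pointwise_lub H (foldr Arr (map \<Delta> xs) Omicron) ((\<lambda>f. ap H f (\<alpha> x)) ` X) (ap H u (\<alpha> x))"
    by simp
  from Cons.IH[OF this imageI[OF Cons.prems(2)] assms(3)] Cons.prems(4) show ?case by simp
qed

text \<open>The induction is on the type \<open>\<sigma>\<close> that remains once the arguments
  \<open>ts\<close> are supplied, whereas \<open>\<sigma>\<^sub>0\<close> stays the full type, at
  which \<open>e\<close> represents the symbol. With all arguments present, the term is a background
  term with the right value, or an atom that is solved if it is true.\<close>

lemma rel_background:
  assumes "\<Sigma> c = Some (foldr Arr (map (\<lambda>_. Iota) ts) \<sigma>)" "fo_ty \<sigma> \<or> \<sigma> = Omicron"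
    "list_all2 (bg_term w) ts ds" "set ds \<subseteq> fdom A" "\<Sigma> c = Some \<sigma>\<^sub>0" "represents H A c \<sigma>\<^sub>0 e"
  shows "rel \<sigma> w (apps (Const c) ts) (foldl (ap H) e ds)"
  using assms(1-4)
proof (induction \<sigma> arbitrary: ts ds w)
  case (Arr \<sigma>\<^sub>1 \<sigma>\<^sub>2)
  then have Iota: "\<sigma>\<^sub>1 = Iota" by auto
  show ?case
    unfolding rel.simps
  proof (intro allI impI, elim conjE)
    fix w' N s assume a: "wle w w'" "world w'" "s \<in> carr H \<sigma>\<^sub>1" "rel \<sigma>\<^sub>1 w' N s"
    have "rel \<sigma>\<^sub>2 w' (apps (Const c) (ts @ [N])) (foldl (ap H) e (ds @ [s]))"
    proof (rule Arr.IH(2))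
      have "list_all2 (bg_term w') ts ds"
        using Arr.prems(3) bg_term_mono[OF _ a(1)] by (auto elim: list_all2_mono)
      then show "list_all2 (bg_term w') (ts @ [N]) (ds @ [s])"
        using a(4) Iota by (auto intro: list_all2_appendI)
    qed (use Arr.prems a(3) Iota carr_Iota in auto)
    then show "rel \<sigma>\<^sub>2 w' (App (apps (Const c) ts) N) (ap H (foldl (ap H) e ds) s)" by simp
  qed
next
  case Iota
  let ?t = "apps (Const c) ts"
  have bg: "\<forall>t \<in> set ts. \<exists>d. bg_term w t d"
    using Iota.prems(3) by (metis list_all2_conv_all_nth in_set_conv_nth)
  have ds: "map (\<lambda>t. fo_val A (snd w) t []) ts = ds"
    using Iota.prems(3) by (auto simp: bg_term_def list_all2_conv_all_nth list_eq_iff_nth_eq)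
  have ty: "has_type \<Delta> \<Sigma> ?t Iota"
    using bg Iota.prems(1)
    by (intro has_type_appsI[of _ _ _ "map (\<lambda>_. Iota) ts"])
      (auto simp: list_all2_conv_all_nth bg_term_def intro: has_type.Const)
  have "foldl (ap H) e ds = fop A c ds"
    using assms(5,6) Iota.prems(1,4) ds
    by (auto simp: represents_def arity_foldr_Arr target_foldr_Arr)
  moreover have "fo_val A (snd w) ?t [] = fop A c ds" using ds by (simp add: fo_val_apps)
  moreover have "\<exists>\<sigma>. \<Sigma> c = Some \<sigma> \<and> fo_ty \<sigma>"
    using assms(5) fo_signature by (auto simp: fo_signature_def)
  ultimately show ?case using ty bg by (auto simp: bg_term_def)
next
  case Omicron
  let ?t = "apps (Const c) ts"
  have bg: "\<forall>t \<in> set ts. \<exists>d. bg_term w t d"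
    using Omicron.prems(3) by (metis list_all2_conv_all_nth in_set_conv_nth)
  have ds: "map (\<lambda>t. fo_val A (snd w) t []) ts = ds"
    using Omicron.prems(3) by (auto simp: bg_term_def list_all2_conv_all_nth list_eq_iff_nth_eq)
  have ty: "has_type \<Delta> \<Sigma> ?t Omicron"
    using bg Omicron.prems(1)
    by (intro has_type_appsI[of _ _ _ "map (\<lambda>_. Iota) ts"])
      (auto simp: list_all2_conv_all_nth bg_term_def intro: has_type.Const)
  have "\<exists>\<sigma>. \<Sigma> c = Some \<sigma> \<and> fo_ty \<sigma>"
    using assms(5) fo_signature by (auto simp: fo_signature_def)
  with ty bg have at: "background_atom \<Delta> \<Sigma> \<Sigma>' ?t"
    using has_type_mono[OF ty sig_le]
    by (auto simp: background_atom_def atom_def fo_formula_def bg_term_def)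
  have "vs ?t \<subseteq> fst w" using bg by (auto simp: bg_term_def)
  moreover have "foldl (ap H) e ds = tv H (frel A c ds)"
    using assms(5,6) Omicron.prems(1,4) ds
    by (auto simp: represents_def arity_foldr_Arr target_foldr_Arr)
  moreover have "fo_holds A (snd w) ?t [] = frel A c ds" using ds by (simp add: fo_holds_apps)
  ultimately show ?case
    using at by (auto simp: preframe_tv[OF preframe] solved_def fo_sat_def intro!: red_solved)
qed

section \<open>The canonical structure\<close>

definition admissible :: "'c \<Rightarrow> ty \<Rightarrow> 'd set" where
  "admissible c \<rho> = {f \<in> carr H \<rho>. \<forall>w. world w \<longrightarrow> rel \<rho> w (Const c) f}"

text \<open>The least upper bound of the admissible elements is itself related to the symbol, hence
  the largest admissible element. The quantifier over \<open>\<sigma>\<close> makes the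
  specification vacuous for symbols outside the signature.\<close>

definition model :: "'c \<Rightarrow> 'd" where
  "model c = (SOME d. \<forall>\<sigma>. \<Sigma>' c = Some \<sigma> \<longrightarrow> d \<in> carr H \<sigma> \<and>
     (if c \<in> dom \<Sigma> then represents H A c \<sigma> d else pointwise_lub H \<sigma> (admissible c \<sigma>) d))"

lemma model:
  assumes "\<Sigma>' c = Some \<sigma>"
  shows "model c \<in> carr H \<sigma>" and "c \<in> dom \<Sigma> \<Longrightarrow> represents H A c \<sigma> (model c)"
    and "c \<notin> dom \<Sigma> \<Longrightarrow> pointwise_lub H \<sigma> (admissible c \<sigma>) (model c)"
proof -
  have "\<exists>d. \<forall>\<sigma>. \<Sigma>' c = Some \<sigma> \<longrightarrow> d \<in> carr H \<sigma> \<and>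
     (if c \<in> dom \<Sigma> then represents H A c \<sigma> d else pointwise_lub H \<sigma> (admissible c \<sigma>) d)"
  proof (cases "c \<in> dom \<Sigma>")
    case True
    then have "\<Sigma> c = Some \<sigma>" using sig_le assms by (auto simp: map_le_def dom_def)
    then have "\<exists>d \<in> carr H \<sigma>. represents H A c \<sigma> d" using expands by (auto simp: expands_def)
    then show ?thesis using assms True by auto
  next
    case False
    then have "rel_ty \<sigma>" using rel_extension assms by (auto simp: rel_extension_def)
    then have "\<exists>u \<in> carr H \<sigma>. pointwise_lub H \<sigma> (admissible c \<sigma>) u"
      using complete by (auto simp: complete_frame_def admissible_def)
    then show ?thesis using assms False by auto
  qed
  from someI_ex[OF this, folded model_def] assms
  show "model c \<in> carr H \<sigma>" and "c \<in> dom \<Sigma> \<Longrightarrow> represents H A c \<sigma> (model c)"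
    and "c \<notin> dom \<Sigma> \<Longrightarrow> pointwise_lub H \<sigma> (admissible c \<sigma>) (model c)" by auto
qed

lemma struct_model: "struct \<Sigma>' H model"
  using model(1) by (simp add: struct_def)

lemma expansion_model: "expansion \<Sigma> \<Sigma>' A H model"
  unfolding expansion_def
proof (intro conjI allI impI)
  fix c \<sigma> assume c: "\<Sigma> c = Some \<sigma>"
  then have "\<Sigma>' c = Some \<sigma>" using sig_le by (auto simp: map_le_def dom_def)
  then show "represents H A c \<sigma> (model c)" using model(2) c by blast
qed (rule struct_model)

lemma rel_Const:
  assumes "\<Sigma>' c = Some \<sigma>" "world w"
  shows "rel \<sigma> w (Const c) (model c)"
proof (cases "c \<in> dom \<Sigma>")
  case True
  then have c: "\<Sigma> c = Some \<sigma>" using sig_le assms by (auto simp: map_le_def dom_def)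
  then have "fo_ty \<sigma>" using fo_signature by (auto simp: fo_signature_def)
  with c show ?thesis
    using rel_background[of c "[]" \<sigma> w "[]" \<sigma> "model c"] model(2)[OF assms(1) True] by simp
next
  case False
  then have "rel_ty \<sigma>" using rel_extension assms by (auto simp: rel_extension_def)
  then show ?thesis
    by (rule rel_lub[OF _ _ model(3)[OF assms(1) False]])
      (use assms in \<open>simp_all add: admissible_def del: split_paired_All\<close>)
qed

text \<open>Induction on typing. An abstraction is handled by \<beta>-expansion on the side of terms
  and by the frame condition on the side of denotations; a symbol is related to its value by the
  choice of \<open>model\<close>.\<close>

lemma fundamental:
  assumes "has_type \<Delta> \<Sigma>' M \<sigma>" "no_logical M" "valuation \<Delta> H \<alpha>" "world w"
    "\<And>x. x \<in> fv M \<Longrightarrow> rel (\<Delta> x) w (substs \<Delta> \<theta>s (Var x)) (\<alpha> x)"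
  shows "rel \<sigma> w (substs \<Delta> \<theta>s M) (denot \<Delta> \<Sigma>' H model M \<alpha>)"
  using assms
proof (induction arbitrary: \<theta>s \<alpha> w)
  case (Var x)
  then show ?case by simp
next
  case (Const c \<sigma>)
  then show ?case using rel_Const by simp
next
  case (App M\<^sub>1 \<sigma>\<^sub>1 \<sigma>\<^sub>2 M\<^sub>2)
  have 1: "rel (\<sigma>\<^sub>1 \<rightarrow>\<^sub>t \<sigma>\<^sub>2) w (substs \<Delta> \<theta>s M\<^sub>1) (denot \<Delta> \<Sigma>' H model M\<^sub>1 \<alpha>)"
    using App.prems by (intro App.IH) auto
  have 2: "rel \<sigma>\<^sub>1 w (substs \<Delta> \<theta>s M\<^sub>2) (denot \<Delta> \<Sigma>' H model M\<^sub>2 \<alpha>)"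
    using App.prems by (intro App.IH) auto
  have 3: "denot \<Delta> \<Sigma>' H model M\<^sub>2 \<alpha> \<in> carr H \<sigma>\<^sub>1"
    using denot_in_carr[OF preframe type_env signature struct_model App.hyps(2) App.prems(2)] .
  have "M\<^sub>1 \<noteq> Neg" using App.prems(1) by auto
  then show ?case using rel_ArrD[OF 1 wle_refl App.prems(3) 3 2] by simp
next
  case (Lam M \<rho> x)
  obtain y \<theta>s' where y: "substs \<Delta> \<theta>s (Lam x M) = Lam y (substs \<Delta> \<theta>s' M)"
    "substs \<Delta> \<theta>s' (Var x) = Var y"
    "\<forall>z \<in> fv M - {x}. substs \<Delta> \<theta>s' (Var z) = substs \<Delta> \<theta>s (Var z) \<and>
       y \<notin> fv (substs \<Delta> \<theta>s (Var z))"
    using substs_Lam[OF type_env] by blast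
  show ?case
    unfolding rel.simps y(1)
  proof (intro allI impI, elim conjE)
    fix w' N s assume a: "wle w w'" "world w'" "s \<in> carr H (\<Delta> x)" "rel (\<Delta> x) w' N s"
    \<comment> \<open>Appending the \<beta>-substitution to the list makes
      \<open>substs \<Delta> \<theta>s'' M\<close> literally the contractum.\<close>
    define \<theta>s'' where "\<theta>s'' = \<theta>s' @ [Var(y := N)]"
    have "rel \<rho> w' (substs \<Delta> \<theta>s'' M) (denot \<Delta> \<Sigma>' H model M (\<alpha>(x := s)))"
    proof (rule Lam.IH)
      show "valuation \<Delta> H (\<alpha>(x := s))" using Lam.prems(2) a(3) by (auto simp: valuation_def)
      fix z assume z: "z \<in> fv M"
      show "rel (\<Delta> z) w' (substs \<Delta> \<theta>s'' (Var z)) ((\<alpha>(x := s)) z)"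
      proof (cases "z = x")
        case True
        then show ?thesis using y(2) a(4) by (simp add: \<theta>s''_def)
      next
        case False
        \<comment> \<open>By freshness of \<open>y\<close>, the \<beta>-substitution does not touch
          the terms substituted for the other variables.\<close>
        have "subst \<Delta> (Var(y := N)) (substs \<Delta> \<theta>s (Var z)) = subst \<Delta> Var (substs \<Delta> \<theta>s (Var z))"
          using y(3) z False by (intro subst_cong) auto
        then have "substs \<Delta> \<theta>s'' (Var z) = substs \<Delta> \<theta>s (Var z)"
          using y(3) z False by (simp add: \<theta>s''_def)
        then show ?thesis
          using Lam.prems(4)[of z] z False rel_mono[OF _ a(1)] by simp
      qed
    qed (use Lam.prems(1) a in auto)
    then have "rel \<rho> w' (App (Lam y (substs \<Delta> \<theta>s' M)) N) (denot \<Delta> \<Sigma>' H model M (\<alpha>(x := s)))"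
      using rel_beta[of \<rho> w' y N "substs \<Delta> \<theta>s' M" "[]"] Lam.hyps(2) by (simp add: \<theta>s''_def)
    moreover have "ap H (denot \<Delta> \<Sigma>' H model (Lam x M) \<alpha>) s = denot \<Delta> \<Sigma>' H model M (\<alpha>(x := s))"
      using frame_beta[OF frame signature struct_model Lam.prems(2) has_type.Lam[OF Lam.hyps] _ a(3)]
        Lam.prems(1) no_logical_pos_ex[of M] by simp
    ultimately show "rel \<rho> w' (App (Lam y (substs \<Delta> \<theta>s' M)) N)
        (ap H (denot \<Delta> \<Sigma>' H model (Lam x M) \<alpha>) s)"
      by (simp only:)
  qed
qed simp_all

section \<open>Truth of the definite clauses in the canonical structure\<close>

lemma rel_individual:
  assumes "\<Delta> x = Iota" "x \<in> fst w"
  shows "rel (\<Delta> x) w (Var x) (snd w x)"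
proof -
  have "has_type \<Delta> \<Sigma> (Var x) Iota" using has_type.Var[of \<Delta> \<Sigma> x] assms(1) by simp
  then show ?thesis using assms by (simp add: bg_term_def)
qed

lemma rel_fresh_Var:
  assumes "x \<in> fst w" "\<Delta> x = Iota \<Longrightarrow> snd w x = d"
  shows "rel (\<Delta> x) w (Var x) d"
proof (cases "\<Delta> x = Iota")
  case True
  then show ?thesis using rel_individual[of x w] assms by simp
next
  case False
  then have "rel_ty (\<Delta> x)" using type_env by (auto simp: type_env_def arg_ty_def)
  then show ?thesis using rel_Var[of "\<Delta> x" w x "[]" d] by simp
qed

text \<open>One resolution step replaces the atom by an instance of the body of a renamed clause.
  The fundamental lemma makes the atoms of that instance reducible, in a world where the renamed
  variables of the clause take their values from \<open>\<beta>\<close>.\<close>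

lemma red_definite:
  assumes D: "Definite G R xs \<in> \<Gamma>"
    and \<beta>: "valuation \<Delta> H \<beta>" "\<forall>M \<in># G. denot \<Delta> \<Sigma>' H model M \<beta> = tv H True"
    and Ns: "length Ns = length xs" "\<forall>i < length xs. rel (\<Delta> (xs ! i)) w (Ns ! i) (\<beta> (xs ! i))"
  shows "red w (apps (Const R) Ns)"
  unfolding red_def goal_ok_def
proof (intro allI impI, elim conjE)
  let ?M = "apps (Const R) Ns" and ?D = "Definite G R xs"
  fix w' K\<^sub>0 w'' K
  assume "\<forall>w'' K. wle w' w'' \<and> world w'' \<and> (\<forall>M \<in># K. solved w'' M) \<longrightarrow> refutable (K\<^sub>0 + K)"
    and w: "wle w w'" "world w'" "wle w' w''" "world w''" and K: "\<forall>M \<in># K. solved w'' M"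
  \<comment> \<open>The goal is moved to the world of \<open>K\<close>, so that the clause can be
    renamed apart from every variable in use.\<close>
  then have ok: "goal_ok w'' K\<^sub>0" unfolding goal_ok_def by (blast intro: wle_trans)
  have fin: "finite (fv_clause ?D)" "finite (fst w'')" using w(4) by (auto simp: world_def)
  obtain \<pi> where \<pi>: "inj_on \<pi> (fv_clause ?D)" "\<forall>x \<in> fv_clause ?D. \<Delta> (\<pi> x) = \<Delta> x"
    "\<pi> ` fv_clause ?D \<inter> fst w'' = {}"
    using type_env_fresh_renaming[OF type_env fin] by blast
  \<comment> \<open>The new world gives each renamed variable the value of the original under
    \<open>\<beta>\<close>. Body variables that do not occur in the head obtain their witnesses in
    this way.\<close>
  define v where "v = (fst w'' \<union> \<pi> ` fv_clause ?D,
    \<lambda>z. if z \<in> \<pi> ` fv_clause ?D then \<beta> (inv_into (fv_clause ?D) \<pi> z) else snd w'' z)"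
  have v_\<pi>: "snd v (\<pi> x) = \<beta> x" "\<pi> x \<in> fst v" if "x \<in> fv_clause ?D" for x
    using that \<pi>(1) by (auto simp: v_def)
  have wv: "wle w'' v" using \<pi>(3) by (auto simp: wle_def v_def)
  have "snd v z \<in> fdom A" if "\<Delta> z = Iota" for z
  proof (cases "z \<in> \<pi> ` fv_clause ?D")
    case True
    then obtain x where x: "x \<in> fv_clause ?D" "z = \<pi> x" by blast
    then have "\<Delta> x = Iota" using \<pi>(2) that by auto
    then have "\<beta> x \<in> fdom A" using \<beta>(1) carr_Iota by (metis valuation_def)
    then show ?thesis using v_\<pi> x by simp
  next
    case False
    then show ?thesis using w(4) that by (auto simp: v_def world_def fo_valuation_def)
  qed
  then have v: "world v" using fin by (auto simp: world_def v_def fo_valuation_def)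
  define \<theta> where "\<theta> = subst_list (map \<pi> xs) Ns"
  \<comment> \<open>Renaming apart and the substitution of the resolution rule stay two separate
    substitutions, as the fundamental lemma permits.\<close>
  define \<theta>s where "\<theta>s = [\<lambda>x. Var (\<pi> x), \<theta>]"
  have dist: "distinct (map \<pi> xs)"
    using D clauses \<pi>(1) by (fastforce simp: distinct_map intro: inj_on_subset)
  have \<theta>s_rel: "rel (\<Delta> x) v (substs \<Delta> \<theta>s (Var x)) (\<beta> x)" if x: "x \<in> fv_clause ?D" for x
  proof (cases "x \<in> set xs")
    case True
    then obtain i where i: "i < length xs" "x = xs ! i" by (auto simp: in_set_conv_nth)
    have "map_of (zip (map \<pi> xs) Ns) (map \<pi> xs ! i) = Some (Ns ! i)"
      using dist i(1) Ns(1) by (intro map_of_zip_nth) auto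
    then have "substs \<Delta> \<theta>s (Var x) = Ns ! i"
      using i by (simp add: \<theta>s_def \<theta>_def subst_list_def)
    moreover have "wle w v" using w wv wle_trans by blast
    ultimately show ?thesis using Ns(2) i rel_mono by metis
  next
    case False
    then have "\<pi> x \<notin> set (map \<pi> xs)" using \<pi>(1) x by (auto simp: inj_on_def)
    then have "map_of (zip (map \<pi> xs) Ns) (\<pi> x) = None"
      using Ns(1) by (simp add: map_of_zip_is_None)
    then have "substs \<Delta> \<theta>s (Var x) = Var (\<pi> x)" by (simp add: \<theta>s_def \<theta>_def subst_list_def)
    then show ?thesis
      using rel_fresh_Var[of "\<pi> x" v "\<beta> x"] v_\<pi>[OF x] \<pi>(2) x by auto
  qed
  have body: "red v (substs \<Delta> \<theta>s M)" if M: "M \<in># G" for M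
  proof -
    have "has_type \<Delta> \<Sigma>' M Omicron" "no_logical M"
      using bspec[OF clauses D] M by (auto simp: atom_def)
    moreover have "x \<in> fv_clause ?D" if "x \<in> fv M" for x
      using M that by auto
    ultimately have "rel Omicron v (substs \<Delta> \<theta>s M) (denot \<Delta> \<Sigma>' H model M \<beta>)"
      using \<beta>(1) v \<theta>s_rel by (intro fundamental) blast+
    then show ?thesis using \<beta>(2) M by simp
  qed
  define G' where "G' = image_mset (subst \<Delta> (\<lambda>x. Var (\<pi> x))) G"
  have "goal_ok v (image_mset (subst \<Delta> \<theta>) G' + K\<^sub>0)"
  proof (rule goal_ok_add)
    show "\<forall>M \<in># image_mset (subst \<Delta> \<theta>) G'. red v M" using body by (auto simp: G'_def \<theta>s_def)
  qed (use goal_ok_mono[OF ok wv] v in auto)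
  moreover have "\<forall>M \<in># K. solved v M" using K solved_mono[OF _ wv] by blast
  ultimately have ref: "refutable (image_mset (subst \<Delta> \<theta>) G' + K\<^sub>0 + K)"
    using v unfolding goal_ok_def by (blast intro: wle_refl)
  have var: "variant \<Delta> ?D (Definite G' R (map \<pi> xs))"
    unfolding variant_def using \<pi> by (intro exI[of _ \<pi>]) (simp add: G'_def)
  show "refutable (add_mset ?M K\<^sub>0 + K)"
  proof (rule refutable_step[OF ref])
    fix \<Gamma>' assume \<Gamma>': "insert (Goal (add_mset ?M K\<^sub>0 + K)) \<Gamma> \<subseteq> \<Gamma>'"
    have "derivable \<Delta> \<Sigma> \<Sigma>' A \<Gamma>' (Goal (K\<^sub>0 + K + image_mset (subst \<Delta> \<theta>) G'))"
      unfolding \<theta>_def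
    proof (rule resolution[OF _ _ _ var])
      show "Goal (add_mset ?M (K\<^sub>0 + K)) \<in> \<Gamma>'" using \<Gamma>' by simp
      show "variant \<Delta> (Goal (add_mset ?M (K\<^sub>0 + K))) (Goal (add_mset ?M (K\<^sub>0 + K)))"
        by (rule variant_refl)
    qed (use D \<Gamma>' Ns(1) in auto)
    then show "derivable \<Delta> \<Sigma> \<Sigma>' A \<Gamma>' (Goal (image_mset (subst \<Delta> \<theta>) G' + K\<^sub>0 + K))"
      by (simp add: ac_simps)
  qed
qed

text \<open>Unfolds the relation at all arguments at once. Each argument may arrive in a larger
  world than its predecessor, so the earlier ones are transported to the last world.\<close>

lemma rel_foldr_Arr:
  assumes "world w"
    and "\<And>w' Ns ss. \<lbrakk>wle w w'; world w'; length Ns = length xs; length ss = length xs;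
      \<forall>i < length xs. ss ! i \<in> carr H (\<Delta> (xs ! i)) \<and> rel (\<Delta> (xs ! i)) w' (Ns ! i) (ss ! i)\<rbrakk> \<Longrightarrow>
      rel Omicron w' (apps M Ns) (foldl (ap H) f ss)"
  shows "rel (foldr Arr (map \<Delta> xs) Omicron) w M f"
  using assms
proof (induction xs arbitrary: w M f)
  case Nil
  then show ?case using Nil.prems(2)[of w "[]" "[]"] by simp
next
  case (Cons x xs)
  have "rel (foldr Arr (map \<Delta> xs) Omicron) v (App M N) (ap H f s)"
    if v: "wle w v" "world v" "s \<in> carr H (\<Delta> x)" "rel (\<Delta> x) v N s" for v N s
  proof (rule Cons.IH[OF v(2)])
    fix w' Ns ss
    assume a: "wle v w'" "world w'" "length Ns = length xs" "length ss = length xs"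
      "\<forall>i < length xs. ss ! i \<in> carr H (\<Delta> (xs ! i)) \<and> rel (\<Delta> (xs ! i)) w' (Ns ! i) (ss ! i)"
    have "rel Omicron w' (apps M (N # Ns)) (foldl (ap H) f (s # ss))"
    proof (rule Cons.prems(2))
      show "wle w w'" using v(1) a(1) by (rule wle_trans)
      show "\<forall>i < length (x # xs). (s # ss) ! i \<in> carr H (\<Delta> ((x # xs) ! i)) \<and>
          rel (\<Delta> ((x # xs) ! i)) w' ((N # Ns) ! i) ((s # ss) ! i)"
        using a(5) v(3) rel_mono[OF v(4) a(1)] by (auto simp: nth_Cons split: nat.split)
    qed (use a in auto)
    then show "rel Omicron w' (apps (App M N) Ns) (foldl (ap H) (ap H f s) ss)" by simp
  qed
  then show ?case by simp
qed

text \<open>If the body is true under \<open>\<alpha>\<close>, abstracting \<open>xs\<close> from it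
  yields an admissible element \<open>f\<close> for \<open>R\<close> that is 1 at the values of
  \<open>xs\<close>. The value of \<open>R\<close> lies above \<open>f\<close>.\<close>

lemma model_definite:
  assumes D: "Definite G R xs \<in> \<Gamma>" and \<alpha>: "valuation \<Delta> H \<alpha>"
  shows "sat_clause \<Delta> \<Sigma>' H model \<alpha> (Definite G R xs)"
proof (cases "\<forall>M \<in># G. denot \<Delta> \<Sigma>' H model M \<alpha> = tv H True")
  case False
  then show ?thesis by (auto simp: sat_Neg)
next
  case True
  have C: "\<forall>M \<in># G. atom \<Delta> \<Sigma>' M" "R \<notin> dom \<Sigma>" "distinct xs"
    "has_type \<Delta> \<Sigma>' (apps (Const R) (map Var xs)) Omicron"
    using bspec[OF clauses D] by simp_all
  let ?\<rho> = "foldr Arr (map \<Delta> xs) Omicron"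
  have R: "\<Sigma>' R = Some ?\<rho>" using C(4) by (rule has_type_apps_VarsD)
  obtain Ms where Ms: "mset Ms = G" by (rule ex_mset[THEN exE])
  have Ms_ty: "\<forall>M \<in> set Ms. has_type \<Delta> \<Sigma>' M Omicron"
    using C(1) Ms by (auto simp: atom_def)
  have "arg_ty Omicron" "finite (set xs \<union> (\<Union>M \<in> set Ms. fv M))" by (simp_all add: arg_ty_def)
  then obtain z where z: "\<Delta> z = Omicron" "z \<notin> set xs \<union> (\<Union>M \<in> set Ms. fv M)"
    by (rule type_env_fresh[OF type_env])
  \<comment> \<open>The fresh variable \<open>z\<close> gets value 1, so that it acts as the
    constant true closing the conjunction.\<close>
  define \<alpha>' where "\<alpha>' = \<alpha>(z := tv H True)"
  have \<alpha>': "valuation \<Delta> H \<alpha>'"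
    using \<alpha> z(1) tv_in_carr[OF preframe] by (auto simp: \<alpha>'_def valuation_def)
  define F where "F = conj_term Ms z"
  have F: "has_type \<Delta> \<Sigma>' F Omicron"
    unfolding F_def using z(1) Ms_ty by (rule has_type_conj_term)
  have F_pos: "pos_ex F"
    unfolding F_def using C(1) Ms by (auto simp: pos_ex_conj_term atom_def intro: no_logical_pos_ex)
  note F_True = denot_conj_term[OF preframe type_env signature struct_model _ z(1) Ms_ty, folded F_def]
  \<comment> \<open>Body variables outside \<open>xs\<close> are not quantified; they keep the
    values they have under \<open>\<alpha>'\<close>, which serve as witnesses. The frame condition
    applies because \<open>F\<close> is positive existential.\<close>
  define f where "f = denot \<Delta> \<Sigma>' H model (foldr Lam xs F) \<alpha>'"
  note f_app = denot_foldr_Lam[OF frame type_env signature struct_model F F_pos C(3) _ _ \<alpha>', folded f_def]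
  have "f \<in> carr H ?\<rho>"
    unfolding f_def
    using denot_in_carr[OF preframe type_env signature struct_model
        has_type_foldr_Lam[OF type_env F] \<alpha>'] .
  \<comment> \<open>If \<open>f\<close> is 1 at \<open>ss\<close>, then \<open>\<beta>\<close> makes
    the whole body true, so resolution with the clause shows that the atom is reducible.\<close>
  moreover have "rel ?\<rho> w (Const R) f" if w: "world w" for w
  proof (rule rel_foldr_Arr[OF w])
    fix w' Ns ss
    assume Ns: "length Ns = length xs" "length ss = length xs"
      "\<forall>i < length xs. ss ! i \<in> carr H (\<Delta> (xs ! i)) \<and> rel (\<Delta> (xs ! i)) w' (Ns ! i) (ss ! i)"
    from Ns(3) have "\<forall>i < length xs. ss ! i \<in> carr H (\<Delta> (xs ! i))" by blast
    from f_app[OF Ns(2) this] obtain \<beta> where \<beta>: "valuation \<Delta> H \<beta>"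
      "\<forall>i < length xs. \<beta> (xs ! i) = ss ! i" "foldl (ap H) f ss = denot \<Delta> \<Sigma>' H model F \<beta>"
      by blast
    have "red w' (apps (Const R) Ns)" if "denot \<Delta> \<Sigma>' H model F \<beta> = tv H True"
      proof (rule red_definite[OF D \<beta>(1) _ Ns(1)])
      show "\<forall>M \<in># G. denot \<Delta> \<Sigma>' H model M \<beta> = tv H True"
        using that F_True[OF \<beta>(1)] by (simp flip: Ms)
      show "\<forall>i < length xs. rel (\<Delta> (xs ! i)) w' (Ns ! i) (\<beta> (xs ! i))"
        using Ns(3) \<beta>(2) by simp
    qed
    then show "rel Omicron w' (apps (Const R) Ns) (foldl (ap H) f ss)" by (simp add: \<beta>(3))
  qed
  ultimately have "f \<in> admissible R ?\<rho>" by (simp add: admissible_def)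
  moreover have "foldl (ap H) f (map \<alpha> xs) = tv H True"
  proof -
    have "\<forall>i < length xs. map \<alpha> xs ! i \<in> carr H (\<Delta> (xs ! i))"
      using \<alpha> by (simp add: valuation_def)
    from f_app[OF length_map this] obtain \<beta> where \<beta>: "valuation \<Delta> H \<beta>"
      "\<forall>i < length xs. \<beta> (xs ! i) = map \<alpha> xs ! i" "\<forall>y. y \<notin> set xs \<longrightarrow> \<beta> y = \<alpha>' y"
      "foldl (ap H) f (map \<alpha> xs) = denot \<Delta> \<Sigma>' H model F \<beta>"
      by blast
    \<comment> \<open>Feeding \<open>f\<close> the values of \<open>xs\<close> under
      \<open>\<alpha>\<close> changes nothing, so the body is evaluated under
      \<open>\<alpha>'\<close>; this differs from \<open>\<alpha>\<close> only at \<open>z\<close>,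
      which does not occur in the body.\<close>
    have \<beta>_eq: "\<beta> y = \<alpha>' y" for y
      using \<beta>(2,3) z(2) by (cases "y \<in> set xs") (auto simp: \<alpha>'_def in_set_conv_nth)
    have "denot \<Delta> \<Sigma>' H model M \<beta> = denot \<Delta> \<Sigma>' H model M \<alpha>" if "M \<in> set Ms" for M
      using that z(2) by (intro denot_cong) (auto simp: \<beta>_eq \<alpha>'_def)
    moreover have "\<beta> z = tv H True" by (simp add: \<beta>_eq \<alpha>'_def)
    ultimately show ?thesis
      unfolding \<beta>(4) using F_True[OF \<beta>(1)] True by (simp flip: Ms)
  qed
  ultimately have "foldl (ap H) (model R) (map \<alpha> xs) = tv H True"
    using pointwise_lub_upper[OF model(3)[OF R C(2)] _ \<alpha>] by blast
  then show ?thesis by (simp add: sat_def denot_apps comp_def)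
qed

section \<open>From a falsified goal clause to a refutation\<close>

lemma refutable_goal:
  assumes G: "Goal G \<in> \<Gamma>" and \<alpha>: "valuation \<Delta> H \<alpha>"
    and true: "\<forall>M \<in># G. denot \<Delta> \<Sigma>' H model M \<alpha> = tv H True"
  shows "refutable G"
proof -
  \<comment> \<open>The initial world records the falsifying valuation on the free variables of the
    goal; identity substitution then meets the premises of the fundamental lemma.\<close>
  define w where "w = (fv_clause (Goal G), \<alpha>)"
  have "\<alpha> x \<in> fdom A" if "\<Delta> x = Iota" for x
    using \<alpha>[unfolded valuation_def, rule_format, of x] that carr_Iota by simp
  then have w: "world w" by (simp add: w_def world_def fo_valuation_def)
  have "red w M" if M: "M \<in># G" for M
  proof -
    have "rel (\<Delta> x) w (Var x) (\<alpha> x)" if "x \<in> fv M" for x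
      using that M by (intro rel_fresh_Var) (auto simp: w_def)
    moreover have "has_type \<Delta> \<Sigma>' M Omicron" "no_logical M"
      using bspec[OF clauses G] M by (auto simp: atom_def)
    ultimately show ?thesis
      using fundamental[of M Omicron \<alpha> w "[]"] \<alpha> true w M by simp
  qed
  \<comment> \<open>The empty goal together with solved atoms is refuted by one constraint
    refutation; the atoms of \<open>G\<close> are then added one by one.\<close>
  moreover have "goal_ok w {#}" unfolding goal_ok_def using refutable_solved by auto
  ultimately have "goal_ok w (G + {#})" using goal_ok_add w by blast
  then have "wle w w \<and> world w \<and> (\<forall>M \<in># {#}. solved w M) \<longrightarrow> refutable (G + {#} + {#})"
    unfolding goal_ok_def by blast
  then show ?thesis using w by simp
qed

text \<open>The canonical structure satisfies all definite clauses, so a clause that it falsifies is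
  a goal clause all of whose atoms are true.\<close>

theorem refutation_exists:
  assumes "\<not> satisfiable \<Delta> \<Sigma> \<Sigma>' A H \<Gamma>"
  shows "\<exists>\<Gamma>'. (step \<Delta> \<Sigma> \<Sigma>' A)\<^sup>*\<^sup>* \<Gamma> \<Gamma>' \<and> empty_clause \<in> \<Gamma>'"
proof -
  have "\<not> (\<forall>C \<in> \<Gamma>. \<forall>\<alpha>. valuation \<Delta> H \<alpha> \<longrightarrow> sat_clause \<Delta> \<Sigma>' H model \<alpha> C)"
    using assms expansion_model by (auto simp only: satisfiable_def)
  then obtain C \<alpha> where C: "C \<in> \<Gamma>" "valuation \<Delta> H \<alpha>" "\<not> sat_clause \<Delta> \<Sigma>' H model \<alpha> C"
    by blast
  obtain G where G: "C = Goal G"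
  proof (cases C)
    case (Definite G R xs)
    with C(1) have "Definite G R xs \<in> \<Gamma>" by simp
    from model_definite[OF this C(2)] C(3) Definite show thesis by simp
  qed
  have "\<forall>M \<in># G. denot \<Delta> \<Sigma>' H model M \<alpha> = tv H True"
    using C(3) by (simp add: G sat_Neg)
  with C(1,2) have "refutable G" unfolding G by (intro refutable_goal)
  then show ?thesis using C(1) G by (simp add: refutable_def)
qed

end

theorem mainTheorem1:
  fixes \<Delta> :: "'v \<Rightarrow> ty"
    and \<Sigma> \<Sigma>' :: "'c sig"
    and A :: "('c, 'd) fo_str"
    and H :: "'d frm"
    and \<Gamma> :: "('c, 'v) clause set"
  assumes "type_env \<Delta>"
    and "fo_signature \<Sigma>"
    and "fo_structure \<Sigma> A"
    and "signature \<Sigma>'"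
    and "rel_extension \<Sigma> \<Sigma>'"
    and "complete_frame TYPE('c) \<Delta> H"
    and "expands \<Sigma> A H"
    and "finite \<Gamma>"
    and "\<forall>C \<in> \<Gamma>. HoCHC \<Delta> \<Sigma> \<Sigma>' C"
    and "\<not> satisfiable \<Delta> \<Sigma> \<Sigma>' A H \<Gamma>"
  shows "\<exists>\<Gamma>'. (\<forall>C \<in> \<Gamma>'. HoCHC \<Delta> \<Sigma> \<Sigma>' C) \<and>
    (step \<Delta> \<Sigma> \<Sigma>' A)\<^sup>*\<^sup>* \<Gamma> (\<Gamma>' \<union> {empty_clause})"
proof -
  interpret hochc \<Delta> \<Sigma> \<Sigma>' A H \<Gamma>
    by unfold_locales (fact assms)+
  obtain \<Gamma>' where \<Gamma>': "(step \<Delta> \<Sigma> \<Sigma>' A)\<^sup>*\<^sup>* \<Gamma> \<Gamma>'" "empty_clause \<in> \<Gamma>'"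
    using refutation_exists[OF assms(10)] by blast
  have "\<forall>C \<in> \<Gamma>'. HoCHC \<Delta> \<Sigma> \<Sigma>' C"
    using HoCHC_steps[OF assms(1) \<Gamma>'(1) assms(9)] .
  moreover have "(step \<Delta> \<Sigma> \<Sigma>' A)\<^sup>*\<^sup>* \<Gamma> (\<Gamma>' \<union> {empty_clause})"
    using \<Gamma>' by (simp add: insert_absorb)
  ultimately show ?thesis by blast
qed

end
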